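(* Let $l,m,n$ be integers with $0<l<m<n$, and let $B\subset\mathbb{R}^n$ be an analytic set with $\dim_{\mathrm{H}}B\leq m-l$. For $V\in G(n-l,m-l)$ write $\mathbb{V}=V\times\mathbb{R}^l\subset\mathbb{R}^n$ and $B_{\mathbb{V}}=\pi_{\mathbb{V}}(B)$, where $\pi_{\mathbb{V}}\colon\mathbb{R}^n\to\mathbb{V}$ is the orthogonal projection. Then $\dim_{\mathrm{H}}B_{\mathbb{V}}=\dim_{\mathrm{H}}B$ for $\gamma_{n-l,m-l}$ almost every $V\in G(n-l,m-l)$.
   Context: $G(d,k)$ is the Grassmannian of $k$-dimensional linear subspaces of $\mathbb{R}^d$, and $\gamma_{d,k}$ is the natural $O(d)$-invariant Borel probability measure on it. $\mathbb{R}^n$ is identified with $\mathbb{R}^{n-l}\times\mathbb{R}^l$, so $\mathbb{V}=V\times\mathbb{R}^l$ is an $m$-dimensional subspace of $\mathbb{R}^n$ containing $\{0\}\times\mathbb{R}^l$. $\dim_{\mathrm{H}}$ denotes Hausdorff dimension. *)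

theory Defs
  imports "HOL-Analysis.Analysis"
begin

section \<open>Hausdorff measure and Hausdorff dimension\<close>

text \<open>
  The \<open>s\<close>-th power of the diameter, with the convention \<open>0\<^sup>0 = 1\<close> for nonempty sets, so that the
  \<open>0\<close>-dimensional measure is counting measure (\<open>0 powr 0 = 0\<close> in the library). It is meant for
  bounded sets only: \<open>diameter\<close> is unspecified on unbounded ones.
\<close>

definition diam_pow :: "real \<Rightarrow> 'a::metric_space set \<Rightarrow> ennreal" where
  "diam_pow s U =
     (if U = {} then 0 else if s = 0 then 1 else ennreal (diameter U powr s))"

definition hausdorff_pre :: "real \<Rightarrow> real \<Rightarrow> 'a::metric_space set \<Rightarrow> ennreal" where
  "hausdorff_pre s \<delta> A =
     (INF U \<in> {U :: nat \<Rightarrow> 'a set.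
          A \<subseteq> (\<Union>i. U i) \<and> (\<forall>i. bounded (U i) \<and> diameter (U i) \<le> \<delta>)}.
        \<Sum>i. diam_pow s (U i))"

definition hausdorff_measure :: "real \<Rightarrow> 'a::metric_space set \<Rightarrow> ennreal" where
  "hausdorff_measure s A = (SUP \<delta> \<in> {0<..}. hausdorff_pre s \<delta> A)"

text \<open>The value is \<open>\<infinity>\<close> if no exponent qualifies; the empty set has dimension \<open>0\<close>.\<close>

definition hausdorff_dim :: "'a::metric_space set \<Rightarrow> ennreal" where
  "hausdorff_dim A = (INF s \<in> {s. 0 \<le> s \<and> hausdorff_measure s A = 0}. ennreal s)"


section \<open>Analytic sets\<close>

text \<open>
  The type \<^typ>\<open>nat \<Rightarrow> nat\<close> carries the product topology of discrete spaces, that is, it is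
  the Baire space.
\<close>

definition analytic_set :: "'a::topological_space set \<Rightarrow> bool" where
  "analytic_set A \<longleftrightarrow>
     A = {} \<or> (\<exists>f :: (nat \<Rightarrow> nat) \<Rightarrow> 'a. continuous_on UNIV f \<and> A = range f)"


section \<open>Orthogonal projections\<close>

definition orth_proj :: "'a::euclidean_space set \<Rightarrow> 'a \<Rightarrow> 'a" where
  "orth_proj V x = (THE p. p \<in> V \<and> (\<forall>v\<in>V. (x - p) \<bullet> v = 0))"

lemma orth_proj_ex1:
  fixes V :: "'a::euclidean_space set"
  assumes "subspace V"
  shows "\<exists>!p. p \<in> V \<and> (\<forall>v\<in>V. (x - p) \<bullet> v = 0)"
proof -
  obtain y z where yz: "y \<in> span V" "\<And>w. w \<in> span V \<Longrightarrow> orthogonal z w" "x = y + z"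
    using orthogonal_subspace_decomp_exists [of V x] by metis
  have V: "span V = V" using assms by (simp add: span_eq_iff)
  show ?thesis
  proof (rule ex1I [of _ y])
    show "y \<in> V \<and> (\<forall>v\<in>V. (x - y) \<bullet> v = 0)"
      using yz V by (auto simp: orthogonal_def)
  next
    fix p assume p: "p \<in> V \<and> (\<forall>v\<in>V. (x - p) \<bullet> v = 0)"
    have "p - y \<in> V" using p yz V assms by (metis subspace_diff)
    then have "(x - p) \<bullet> (p - y) = 0" "(x - y) \<bullet> (p - y) = 0"
      using p yz V by (auto simp: orthogonal_def)
    then have "(p - y) \<bullet> (p - y) = 0" by (simp add: inner_diff_left)
    then show "p = y" by simp
  qed
qed

lemma orth_proj_mem: "subspace V \<Longrightarrow> orth_proj V x \<in> V"
  and orth_proj_inner: "subspace V \<Longrightarrow> v \<in> V \<Longrightarrow> (x - orth_proj V x) \<bullet> v = 0"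
  using theI' [OF orth_proj_ex1, of V x, folded orth_proj_def] by auto

lemma orth_proj_eqI:
  assumes "subspace V" "p \<in> V" "\<And>v. v \<in> V \<Longrightarrow> (x - p) \<bullet> v = 0"
  shows "orth_proj V x = p"
  unfolding orth_proj_def using assms by (intro the1_equality orth_proj_ex1) auto

lemma bounded_linear_orth_proj:
  assumes "subspace V"
  shows "bounded_linear (orth_proj V)"
proof -
  have "linear (orth_proj V)"
  proof (rule linearI)
    fix x y
    show "orth_proj V (x + y) = orth_proj V x + orth_proj V y"
    proof (rule orth_proj_eqI [OF assms])
      fix v assume "v \<in> V"
      then show "(x + y - (orth_proj V x + orth_proj V y)) \<bullet> v = 0"
        using orth_proj_inner [OF assms, of v x] orth_proj_inner [OF assms, of v y]
        by (simp add: inner_diff_left inner_add_left)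
    qed (intro subspace_add assms orth_proj_mem)
  next
    fix c x
    show "orth_proj V (c *\<^sub>R x) = c *\<^sub>R orth_proj V x"
    proof (rule orth_proj_eqI [OF assms])
      fix v assume "v \<in> V"
      then show "(c *\<^sub>R x - c *\<^sub>R orth_proj V x) \<bullet> v = 0"
        using orth_proj_inner [OF assms, of v x] by (simp add: inner_diff_left)
    qed (intro subspace_scale assms orth_proj_mem)
  qed
  then show ?thesis by (simp add: linear_conv_bounded_linear)
qed


section \<open>Grassmannians and their invariant measures\<close>

definition grassmannian :: "nat \<Rightarrow> 'a::euclidean_space set set" where
  "grassmannian k = {V. subspace V \<and> dim V = k}"

text \<open>
  The operator-norm distance of the orthogonal projections. The value \<open>0\<close> off the subspaces is a
  dummy: \<^locale>\<open>Metric_space\<close> demands symmetry and nonnegativity for all arguments.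
\<close>

definition grassmann_dist :: "'a::euclidean_space set \<Rightarrow> 'a set \<Rightarrow> real" where
  "grassmann_dist V W =
     (if subspace V \<and> subspace W then onorm (\<lambda>x. orth_proj V x - orth_proj W x) else 0)"

lemma Metric_space_grassmannian: "Metric_space (grassmannian k) grassmann_dist"
proof
  have bl: "bounded_linear (\<lambda>x. orth_proj V x - orth_proj W x)"
    if "subspace V" "subspace W" for V W :: "'a set"
    using that by (intro bounded_linear_sub bounded_linear_orth_proj)
  fix V W Z :: "'a set"
  show "0 \<le> grassmann_dist V W"
    by (simp add: grassmann_dist_def onorm_pos_le bl)
  show "grassmann_dist V W = grassmann_dist W V"
    by (simp add: grassmann_dist_def onorm_def norm_minus_commute)
  show "grassmann_dist V W = 0 \<longleftrightarrow> V = W" if "V \<in> grassmannian k" "W \<in> grassmannian k"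
  proof -
    have VW: "subspace V" "subspace W" using that by (auto simp: grassmannian_def)
    have fixed: "x \<in> U \<longleftrightarrow> orth_proj U x = x" if "subspace U" for U and x :: 'a
      by (metis orth_proj_mem orth_proj_eqI that diff_self inner_zero_left)
    have "V = W" if "\<forall>x. orth_proj V x = orth_proj W x"
      by (intro set_eqI) (metis that fixed VW)
    then show ?thesis
      using VW onorm_eq_0 [OF bl [OF VW]] by (auto simp: grassmann_dist_def onorm_zero)
  qed
  show "grassmann_dist V Z \<le> grassmann_dist V W + grassmann_dist W Z"
    if "V \<in> grassmannian k" "W \<in> grassmannian k" "Z \<in> grassmannian k"
  proof -
    have "subspace V" "subspace W" "subspace Z" using that by (auto simp: grassmannian_def)
    then show ?thesis
      using onorm_triangle [OF bl [of V W] bl [of W Z]] by (simp add: grassmann_dist_def)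
  qed
qed

definition grassmann_borel :: "nat \<Rightarrow> 'a::euclidean_space set measure" where
  "grassmann_borel k =
     sigma (grassmannian k)
       {U. openin (Metric_space.mtopology (grassmannian k) grassmann_dist) U}"

text \<open>
  For \<open>k \<le> DIM('a)\<close> there is exactly one such measure, because the orthogonal group is compact and
  acts transitively on the Grassmannian.
\<close>

definition invariant_grassmann_measure :: "nat \<Rightarrow> 'a::euclidean_space set measure \<Rightarrow> bool" where
  "invariant_grassmann_measure k \<gamma> \<longleftrightarrow>
     space \<gamma> = grassmannian k \<and> sets \<gamma> = sets (grassmann_borel k) \<and> emeasure \<gamma> (space \<gamma>) = 1 \<and>
     (\<forall>g A. orthogonal_transformation g \<longrightarrow> A \<in> sets \<gamma> \<longrightarrow>
        emeasure \<gamma> ((\<lambda>V. g ` V) ` A) = emeasure \<gamma> A)"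

end

theory Submission
  imports Defs
begin

text \<open>
  The upper bound holds because projections are contractions. For the lower bound, let
  \<open>0 < s < t < dim B\<close>. Instead of a Frostman measure we use discrete measures \<open>\<mu>\<^sub>j\<close> of equal mass
  that satisfy the Frostman condition with exponent \<open>t\<close> down to scale \<open>2\<^sup>-\<^sup>j\<close> and whose supports
  converge to a compact set \<open>K \<subseteq> B\<close>. The set \<open>K\<close> comes from Choquet's capacitability argument for the
  dyadic Hausdorff content, which is strongly subadditive because dyadic cubes are nested or disjoint;
  the measures come from a greedy form of max-flow min-cut on dyadic cubes. The energies
  \<open>\<Sum> \<mu>\<^sub>j x \<mu>\<^sub>j y max (|x - y|, 2\<^sup>-\<^sup>j)\<^sup>-\<^sup>s\<close> are then bounded. As \<open>s < m - l\<close>, invariance of \<open>\<gamma>\<close>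
  bounds the averages over \<open>V\<close> of the energies of the projected measures, so by Fatou's lemma
  almost every \<open>V\<close> has bounded projected energies along a subsequence. For such \<open>V\<close> a finite
  subcover of any cover of the projection of \<open>K\<close> and the Cauchy-Schwarz inequality bound the
  \<open>s\<close>-dimensional content of the projection from below.
\<close>

section \<open>Contents built from nested cells\<close>

text \<open>Weak limits of measures are avoided by cutting off the kernel of the j-th measure at
  2^-j, the finest scale at which its Frostman bound is known. Once 2^-j drops below the thickened
  diameters of a fixed finite cover, the cutoff is invisible to the covering estimate. A second
  difficulty is that only V varies while the factor R^l is kept. A vector z = (u, v) with |v| >=
  |z|/2 is never shortened below |z|/2, so averaging is needed only when |u| > |z|/2. There the
  event |pi_V u| <= delta |u| has probability O(delta^(m-l)), which makes |pi_V u|^-s integrable for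
  s < m - l. This is where dim B <= m - l enters: all exponents used lie below dim B. The
  probability bound rests on invariance alone, which makes the probability the same for all
  directions. The gap s < t turns the dyadic sums of the energies into convergent geometric
  series.\<close>

locale refining_cells =
  fixes P :: "nat \<Rightarrow> 'a \<Rightarrow> 'i" and c :: "nat \<Rightarrow> real"
  assumes refine: "P (Suc k) x = P (Suc k) y \<Longrightarrow> P k x = P k y"
    and c_pos: "0 < c k"
begin

text \<open>A pair \<open>(k, i)\<close> stands for the cell of points whose level-\<open>k\<close>
  label is \<open>i\<close>; by \<open>refine\<close>, a larger \<open>k\<close> means smaller
  cells.\<close>

definition cover :: "(nat \<times> 'i) set \<Rightarrow> 'a set" where
  "cover C = {x. \<exists>k. (k, P k x) \<in> C}"

text \<open>A weighted counting measure, so that modularity, subadditivity and continuity along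
  increasing unions come from measure theory, even for infinite families of cells.\<close>

definition cost :: "(nat \<times> 'i) set \<Rightarrow> ennreal" where
  "cost C = emeasure (density (count_space UNIV) (\<lambda>q. ennreal (c (fst q)))) C"

definition content :: "'a set \<Rightarrow> ennreal" where
  "content A = (INF C \<in> {C. A \<subseteq> cover C}. cost C)"

text \<open>The cells of \<open>C\<close> that lie in no coarser cell of \<open>C\<close>. A label
  taken by no point is kept, since the condition is then vacuous.\<close>

definition maximal :: "(nat \<times> 'i) set \<Rightarrow> (nat \<times> 'i) set" where
  "maximal C = {q \<in> C. \<forall>x k. P (fst q) x = snd q \<longrightarrow> k < fst q \<longrightarrow> (k, P k x) \<notin> C}"

lemma refine_le: "j \<le> k \<Longrightarrow> P k x = P k y \<Longrightarrow> P j x = P j y"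
  by (induction rule: inc_induct) (auto intro: refine)

lemma cost_mono: "C \<subseteq> D \<Longrightarrow> cost C \<le> cost D"
  unfolding cost_def by (intro emeasure_mono) auto

lemma cover_mono: "C \<subseteq> D \<Longrightarrow> cover C \<subseteq> cover D"
  by (auto simp: cover_def)

lemma cost_Un_Int: "cost (C \<union> D) + cost (C \<inter> D) = cost C + cost D"
  unfolding cost_def by (subst emeasure_Un_Int) auto

lemma cost_finite:
  assumes "finite C" shows "cost C = ennreal (\<Sum>q\<in>C. c (fst q))"
  unfolding cost_def using assms
  by (simp add: emeasure_density nn_integral_count_space_indicator [symmetric]
      nn_integral_count_space_finite sum_ennreal less_imp_le [OF c_pos])

lemma content_le: "A \<subseteq> cover C \<Longrightarrow> content A \<le> cost C"
  unfolding content_def by (rule INF_lower) simp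

lemma content_mono: "A \<subseteq> B \<Longrightarrow> content A \<le> content B"
  unfolding content_def by (rule INF_superset_mono) auto

text \<open>Among the cells of \<open>C\<close> around a covered point, the one of least level is
  maximal; it exists because levels are natural numbers.\<close>

lemma cover_maximal: "cover (maximal C) = cover C"
proof
  show "cover (maximal C) \<subseteq> cover C" by (auto simp: cover_def maximal_def)
  show "cover C \<subseteq> cover (maximal C)"
  proof
    fix x assume "x \<in> cover C"
    then have ex: "\<exists>k. (k, P k x) \<in> C" by (auto simp: cover_def)
    define k where "k = (LEAST k. (k, P k x) \<in> C)"
    have k: "(k, P k x) \<in> C" unfolding k_def using ex by (rule LeastI_ex)
    have "(j, P j y) \<notin> C" if "P k y = P k x" "j < k" for j y
      using refine_le [OF less_imp_le, OF that(2,1)] that(2) not_less_Least [of j "\<lambda>k. (k, P k x) \<in> C"]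
      by (simp add: k_def)
    then have "(k, P k x) \<in> maximal C" using k by (simp add: maximal_def)
    then show "x \<in> cover (maximal C)" by (auto simp: cover_def)
  qed
qed

text \<open>A point covered twice lies in two nested cells, only one of which can be maximal.\<close>

lemma cost_maximal_Un:
  assumes "A \<subseteq> cover C" "A \<subseteq> cover D"
  shows "cost (maximal (C \<union> D)) + content A \<le> cost C + cost D"
proof -
  let ?E = "C \<union> D - maximal (C \<union> D)"
  have "A \<subseteq> cover (?E \<union> (C \<inter> D))"
  proof
    fix x assume "x \<in> A"
    then have "x \<in> cover C" "x \<in> cover D" using assms by auto
    then obtain j k where jk: "(j, P j x) \<in> C" "(k, P k x) \<in> D"
      by (auto simp: cover_def)
    consider "j < k" | "k < j" | "j = k" by linarith
    then show "x \<in> cover (?E \<union> (C \<inter> D))"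
    proof cases
      case 1
      then have "(k, P k x) \<notin> maximal (C \<union> D)" using jk by (auto simp: maximal_def)
      then show ?thesis using jk by (auto simp: cover_def)
    next
      case 2
      then have "(j, P j x) \<notin> maximal (C \<union> D)" using jk by (auto simp: maximal_def)
      then show ?thesis using jk by (auto simp: cover_def)
    qed (use jk in \<open>auto simp: cover_def\<close>)
  qed
  then have "content A \<le> cost (?E \<union> (C \<inter> D))" by (rule content_le)
  also have "\<dots> \<le> cost ?E + cost (C \<inter> D)"
    unfolding cost_def by (rule emeasure_subadditive) auto
  finally have "cost (maximal (C \<union> D)) + content A
      \<le> (cost (maximal (C \<union> D)) + cost ?E) + cost (C \<inter> D)"
    by (simp add: add.assoc add_left_mono)
  also have "cost (maximal (C \<union> D)) + cost ?E = cost (C \<union> D)"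
    using cost_Un_Int [of "maximal (C \<union> D)" ?E]
    by (simp add: cost_def maximal_def Un_absorb1 subset_iff)
  finally show ?thesis by (simp add: cost_Un_Int)
qed

text \<open>Covers \<open>C i\<close> that are nearly optimal for \<open>A i\<close> are merged one
  at a time. The old union and the new cover both contain \<open>A n\<close>, so
  \<open>cost_maximal_Un\<close> gives back \<open>content (A n)\<close>, and only the errors
  \<open>e * (1/2)^Suc i\<close> add up.\<close>

lemma content_incseq:
  assumes "incseq A"
  shows "content (\<Union>i. A i) = (SUP i. content (A i))"
proof (rule antisym)
  let ?S = "SUP i. content (A i)"
  show "?S \<le> content (\<Union>i. A i)" by (intro SUP_least content_mono) auto
  show "content (\<Union>i. A i) \<le> ?S"
  proof (rule ennreal_le_epsilon)
    fix e :: real assume "?S < top" "0 < e"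
    have fin: "content (A i) < top" for i
      using \<open>?S < top\<close> by (rule le_less_trans [rotated]) (rule SUP_upper, simp)
    have "\<exists>C. A i \<subseteq> cover C \<and> cost C < content (A i) + ennreal (e * (1/2)^Suc i)" for i
    proof -
      have "content (A i) < content (A i) + ennreal (e * (1/2)^Suc i)"
        using fin[of i] \<open>0 < e\<close> by (cases "content (A i)") (auto simp: ennreal_plus [symmetric] ennreal_less_iff simp del: ennreal_plus)
      then show ?thesis unfolding content_def INF_less_iff by (auto simp: content_def)
    qed
    then obtain C where C: "\<And>i. A i \<subseteq> cover (C i)"
      and cost: "\<And>i. cost (C i) \<le> content (A i) + ennreal (e * (1/2)^Suc i)"
      by (metis less_imp_le)
    define T where "T n = (\<Union>i\<le>n. C i)" for n
    have A_T: "A n \<subseteq> cover (T n)" for n using C[of n] cover_mono[of "C n" "T n"] by (auto simp: T_def)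
    have T_Suc: "T (Suc n) = T n \<union> C (Suc n)" for n by (auto simp: T_def atMost_Suc)
    \<comment> \<open>The factor \<open>1 - (1/2)^Suc n\<close> is the sum of
      \<open>(1/2)^Suc i\<close> over \<open>i \<le> n\<close>.\<close>
    have bound: "cost (maximal (T n)) \<le> content (A n) + ennreal (e * (1 - (1/2)^Suc n))" for n
    proof (induction n)
      case 0
      have "cost (maximal (T 0)) \<le> cost (C 0)" by (rule cost_mono) (auto simp: T_def maximal_def)
      also note cost[of 0]
      finally show ?case by simp
    next
      case (Suc n)
      \<comment> \<open>A cell of \<open>T n\<close> that is maximal in the larger family is already
        maximal in \<open>T n\<close>.\<close>
      have "maximal (T (Suc n)) \<subseteq> maximal (maximal (T n) \<union> C (Suc n))"
        unfolding T_Suc by (auto simp: maximal_def)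
      then have "cost (maximal (T (Suc n))) + content (A n)
          \<le> cost (maximal (maximal (T n) \<union> C (Suc n))) + content (A n)"
        by (intro add_right_mono cost_mono)
      also have "\<dots> \<le> cost (maximal (T n)) + cost (C (Suc n))"
        using A_T[of n] C[of "Suc n"] incseq_SucD[OF assms, of n]
        by (intro cost_maximal_Un) (auto simp: cover_maximal)
      also have "\<dots> \<le> (content (A n) + ennreal (e * (1 - (1/2)^Suc n)))
          + (content (A (Suc n)) + ennreal (e * (1/2)^Suc (Suc n)))"
        by (intro add_mono Suc.IH cost)
      also have "\<dots> = content (A n) + (content (A (Suc n)) +
          (ennreal (e * (1 - (1/2)^Suc n)) + ennreal (e * (1/2)^Suc (Suc n))))"
        by (simp only: ac_simps)
      also have "ennreal (e * (1 - (1/2)^Suc n)) + ennreal (e * (1/2)^Suc (Suc n))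
          = ennreal (e * (1 - (1/2)^Suc (Suc n)))"
      proof (subst ennreal_plus [symmetric])
        show "0 \<le> e * (1 - (1/2)^Suc n)" "0 \<le> e * (1/2)^Suc (Suc n)"
          using \<open>0 < e\<close> power_le_one [of "1/2::real" "Suc n"] by auto
      qed (simp add: algebra_simps)
      \<comment> \<open>Both sides carry \<open>content (A n)\<close>, which is finite and
        cancels.\<close>
      finally show ?case
        using fin[of n]
        by (auto simp: add.commute [of "cost _"] ennreal_add_left_cancel_le simp del: power_Suc)
    qed
    have "A n \<subseteq> cover (\<Union>n. T n)" for n
      using A_T[of n] cover_mono[of "T n" "\<Union>n. T n"] by blast
    then have "content (\<Union>i. A i) \<le> cost (maximal (\<Union>n. T n))"
      by (intro content_le) (simp add: cover_maximal UN_subset_iff)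
    \<comment> \<open>Each maximal cell of the full union lies in some \<open>T n\<close> and is
      maximal there. The pieces increase with \<open>n\<close>, so the cost is a supremum.\<close>
    also have "maximal (\<Union>n. T n) = (\<Union>n. maximal (\<Union>n. T n) \<inter> T n)"
      by (auto simp: maximal_def)
    also have "cost \<dots> = (SUP n. cost (maximal (\<Union>n. T n) \<inter> T n))"
      unfolding cost_def
      by (intro SUP_emeasure_incseq [symmetric] incseq_SucI) (auto simp: T_Suc)
    also have "\<dots> \<le> ?S + ennreal e"
    proof (rule SUP_least)
      fix n
      have "cost (maximal (\<Union>n. T n) \<inter> T n) \<le> cost (maximal (T n))"
        by (intro cost_mono) (auto simp: maximal_def)
      also note bound[of n]
      also have "content (A n) + ennreal (e * (1 - (1/2)^Suc n)) \<le> ?S + ennreal e"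
        using \<open>0 < e\<close> by (intro add_mono SUP_upper ennreal_leI) (auto simp: algebra_simps)
      finally show "cost (maximal (\<Union>n. T n) \<inter> T n) \<le> ?S + ennreal e" .
    qed
    finally show "content (\<Union>i. A i) \<le> ?S + ennreal e" .
  qed
qed

text \<open>The points are processed one by one, each receiving as much mass as the cells allow.\<close>

lemma greedy_weights:
  assumes "finite X"
  obtains w :: "'a \<Rightarrow> real" where "\<And>x. 0 \<le> w x"
    "\<And>k i. k \<le> N \<Longrightarrow> (\<Sum>x | x \<in> X \<and> P k x = i. w x) \<le> c k"
    "\<And>x. x \<in> X \<Longrightarrow> \<exists>k\<le>N. (\<Sum>y | y \<in> X \<and> P k y = P k x. w y) = c k"
proof -
  have "\<exists>w::'a \<Rightarrow> real. (\<forall>x. 0 \<le> w x) \<and>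
    (\<forall>k i. k \<le> N \<longrightarrow> (\<Sum>x | x \<in> X \<and> P k x = i. w x) \<le> c k) \<and>
    (\<forall>x\<in>X. \<exists>k\<le>N. (\<Sum>y | y \<in> X \<and> P k y = P k x. w y) = c k)"
    using assms
  proof induction
    case empty
    show ?case by (intro exI[of _ "\<lambda>_. 0"]) (auto simp: less_imp_le c_pos)
  next
    case (insert a X)
    from insert.IH obtain w :: "'a \<Rightarrow> real" where IH: "(\<forall>x. 0 \<le> w x) \<and>
        (\<forall>k i. k \<le> N \<longrightarrow> (\<Sum>x | x \<in> X \<and> P k x = i. w x) \<le> c k) \<and>
        (\<forall>x\<in>X. \<exists>k\<le>N. (\<Sum>y | y \<in> X \<and> P k y = P k x. w y) = c k)"
      by (rule exE)
    have w: "\<And>x. 0 \<le> w x"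
      "\<And>k i. k \<le> N \<Longrightarrow> (\<Sum>x | x \<in> X \<and> P k x = i. w x) \<le> c k"
      "\<And>x. x \<in> X \<Longrightarrow> \<exists>k\<le>N. (\<Sum>y | y \<in> X \<and> P k y = P k x. w y) = c k"
      using IH by simp_all
    \<comment> \<open>\<open>r k\<close> is the capacity left in the level-\<open>k\<close> cell of
      \<open>a\<close>. The new point receives the minimum \<open>m\<close>, which saturates its
      cell at level \<open>k0\<close>.\<close>
    define r where "r k = c k - (\<Sum>y | y \<in> X \<and> P k y = P k a. w y)" for k
    define m where "m = Min (r ` {..N})"
    have m_le: "m \<le> r k" if "k \<le> N" for k unfolding m_def using that by (intro Min_le) auto
    have "m \<in> r ` {..N}" unfolding m_def by (rule Min_in) auto
    then obtain k0 where k0: "k0 \<le> N" "m = r k0" by auto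
    have "0 \<le> m" using k0 w(2)[of k0 "P k0 a"] by (simp add: r_def)
    define v where "v = w(a := m)"
    have sum_v: "(\<Sum>x | x \<in> insert a X \<and> P k x = i. v x)
        = (\<Sum>x | x \<in> X \<and> P k x = i. w x) + (if P k a = i then m else 0)" for k i
    proof -
      have *: "(\<Sum>x | x \<in> X \<and> P k x = i. v x) = (\<Sum>x | x \<in> X \<and> P k x = i. w x)"
        by (rule sum.cong) (use insert.hyps in \<open>auto simp: v_def\<close>)
      show ?thesis
      proof (cases "P k a = i")
        case True
        then have "{x. x \<in> insert a X \<and> P k x = i} = insert a {x \<in> X. P k x = i}" by auto
        then show ?thesis using True insert.hyps * by (simp add: v_def)
      next
        case False
        then have "{x. x \<in> insert a X \<and> P k x = i} = {x \<in> X. P k x = i}" by auto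
        then show ?thesis using False * by simp
      qed
    qed
    have feas: "(\<Sum>x | x \<in> insert a X \<and> P k x = i. v x) \<le> c k" if "k \<le> N" for k i
      unfolding sum_v using m_le[OF that] w(2)[OF that, of i] by (auto simp: r_def)
    show ?case
    proof (intro exI[of _ v] conjI allI impI ballI)
      show "0 \<le> v x" for x using w \<open>0 \<le> m\<close> by (simp add: v_def)
      fix x assume x: "x \<in> insert a X"
      show "\<exists>k\<le>N. (\<Sum>y | y \<in> insert a X \<and> P k y = P k x. v y) = c k"
      proof (cases "x = a")
        case True
        then show ?thesis using k0 by (intro exI[of _ k0]) (simp only: sum_v, simp add: r_def)
      next
        case False
        then obtain k where k: "k \<le> N" "(\<Sum>y | y \<in> X \<and> P k y = P k x. w y) = c k"
          using w(3) x by auto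
        \<comment> \<open>Adding mass keeps an old saturated cell full, because feasibility forbids
          exceeding \<open>c k\<close>.\<close>
        have "c k \<le> (\<Sum>y | y \<in> insert a X \<and> P k y = P k x. v y)"
          unfolding sum_v using k \<open>0 \<le> m\<close> by simp
        then show ?thesis using k(1) antisym [OF feas [OF k(1)]] by blast
      qed
    qed (use feas in auto)
  qed
  then show thesis using that by blast
qed

text \<open>Duality of flow and cut: the coarsest saturated cells around the points of
  \<open>X\<close> are pairwise disjoint and cover \<open>A\<close>. Their cost equals the total
  mass, which is therefore at least the content.\<close>

lemma frostman_weights:
  assumes fin: "finite (P N ` A)"
  obtains X w where "finite X" "X \<subseteq> A" "\<And>x. 0 \<le> w x" "content A \<le> ennreal (\<Sum>x\<in>X. w x)"
    "\<And>k i. k \<le> N \<Longrightarrow> (\<Sum>x | x \<in> X \<and> P k x = i. w x) \<le> c k"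
proof -
  \<comment> \<open>\<open>X\<close> meets every level-\<open>N\<close> cell that meets
    \<open>A\<close>, and a cell of level at most \<open>N\<close> around a point contains the whole
    level-\<open>N\<close> cell of that point.\<close>
  obtain X where X: "X \<subseteq> A" "finite X" "P N ` A = P N ` X"
    using finite_subset_image [OF fin order_refl] by blast
  obtain w where w: "\<And>x. 0 \<le> w x"
    "\<And>k i. k \<le> N \<Longrightarrow> (\<Sum>x | x \<in> X \<and> P k x = i. w x) \<le> c k"
    "\<And>x. x \<in> X \<Longrightarrow> \<exists>k\<le>N. (\<Sum>y | y \<in> X \<and> P k y = P k x. w y) = c k"
    by (rule greedy_weights [OF \<open>finite X\<close>, of N]) blast
  define sat where "sat k i \<longleftrightarrow> k \<le> N \<and> (\<Sum>y | y \<in> X \<and> P k y = i. w y) = c k" for k i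
  define q where "q x = (LEAST k. sat k (P k x))" for x
  have sat_q: "sat (q x) (P (q x) x)" if "x \<in> X" for x
    unfolding q_def using w(3)[OF that]
    by (intro LeastI_ex [of "\<lambda>k. sat k (P k x)"]) (auto simp: sat_def)
  have q_le: "q x \<le> k" if "sat k (P k x)" for x k
    unfolding q_def by (rule Least_le) (rule that)
  define g where "g x = (q x, P (q x) x)" for x
  \<comment> \<open>All points of \<open>X\<close> in the coarsest saturated cell of
    \<open>x\<close> have that same cell as their own coarsest one, so the fibres of
    \<open>g\<close> are cells restricted to \<open>X\<close>.\<close>
  have g_eq: "{y \<in> X. g y = g x} = {y \<in> X. P (q x) y = P (q x) x}" if "x \<in> X" for x
  proof (intro Collect_cong conj_cong refl iffI)
    fix y assume y: "y \<in> X" "P (q x) y = P (q x) x"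
    have 1: "q y \<le> q x" using y sat_q[OF that] by (intro q_le) simp
    then have 2: "P (q y) y = P (q y) x" using refine_le y by blast
    then have "q x \<le> q y" using sat_q[OF y(1)] by (intro q_le) simp
    with 1 2 show "g y = g x" by (simp add: g_def)
  qed (auto simp: g_def)
  have "A \<subseteq> cover (g ` X)"
  proof
    fix a assume "a \<in> A"
    then obtain x where x: "x \<in> X" "P N a = P N x" using X(3) by blast
    have "q x \<le> N" using sat_q[OF x(1)] by (simp add: sat_def)
    then have "P (q x) a = P (q x) x" using refine_le x by blast
    then have "(q x, P (q x) a) \<in> g ` X" using x by (auto simp: g_def)
    then show "a \<in> cover (g ` X)" by (auto simp: cover_def)
  qed
  then have "content A \<le> cost (g ` X)" by (rule content_le)
  also have "cost (g ` X) = ennreal (\<Sum>d\<in>g ` X. c (fst d))"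
    using \<open>finite X\<close> by (intro cost_finite) simp
  also have "(\<Sum>d\<in>g ` X. c (fst d)) = (\<Sum>d\<in>g ` X. \<Sum>y | y \<in> X \<and> g y = d. w y)"
  proof (rule sum.cong [OF refl])
    fix d assume "d \<in> g ` X"
    then obtain x where x: "x \<in> X" "d = g x" by auto
    then show "c (fst d) = (\<Sum>y | y \<in> X \<and> g y = d. w y)"
      using g_eq[OF x(1)] sat_q[OF x(1)] by (simp add: sat_def g_def)
  qed
  also have "\<dots> = (\<Sum>x\<in>X. w x)"
    using \<open>finite X\<close> by (intro sum.group) auto
  finally show thesis using that X w by blast
qed

end

section \<open>Dyadic cubes\<close>

text \<open>The label of the half-open cube of side \<open>(1/2) ^ k\<close> around
  \<open>x\<close>. Restriction to \<open>Basis\<close> makes labels extensional, so that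
  \<open>PiE\<close> yields finiteness, counts and countability.\<close>

definition dyadic :: "nat \<Rightarrow> 'a::euclidean_space \<Rightarrow> 'a \<Rightarrow> int" where
  "dyadic k x = (\<lambda>b\<in>Basis. \<lfloor>2 ^ k * (x \<bullet> b)\<rfloor>)"

lemma dyadic_refine:
  assumes "dyadic (Suc k) x = dyadic (Suc k) y"
  shows "dyadic k x = dyadic k y"
proof -
  have half: "\<lfloor>2 ^ k * t\<rfloor> = \<lfloor>2 ^ Suc k * t\<rfloor> div 2" for t :: real
    using floor_divide_real_eq_div [of 2 "2 ^ Suc k * t"] by simp
  have "\<lfloor>2 ^ Suc k * (x \<bullet> b)\<rfloor> = \<lfloor>2 ^ Suc k * (y \<bullet> b)\<rfloor>" if "b \<in> Basis" for b
    using fun_cong [OF assms, of b] that by (simp add: dyadic_def)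
  then show ?thesis
    unfolding dyadic_def half by (intro restrict_ext) simp
qed

lemma norm_diff_le_of_dyadic_eq:
  fixes x y :: "'a::euclidean_space"
  assumes "dyadic k x = dyadic k y"
  shows "norm (x - y) \<le> DIM('a) * (1/2) ^ k"
proof -
  have "\<bar>(x - y) \<bullet> b\<bar> \<le> (1/2) ^ k" if "b \<in> Basis" for b
  proof -
    have "\<lfloor>2 ^ k * (x \<bullet> b)\<rfloor> = \<lfloor>2 ^ k * (y \<bullet> b)\<rfloor>"
      using fun_cong [OF assms, of b] that by (simp add: dyadic_def)
    then have "\<bar>2 ^ k * (x \<bullet> b) - 2 ^ k * (y \<bullet> b)\<bar> \<le> 1" by linarith
    also have "2 ^ k * (x \<bullet> b) - 2 ^ k * (y \<bullet> b) = 2 ^ k * ((x - y) \<bullet> b)"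
      by (simp add: algebra_simps)
    finally show ?thesis by (simp add: abs_mult field_simps)
  qed
  then have "(\<Sum>b\<in>Basis. \<bar>(x - y) \<bullet> b\<bar>) \<le> (\<Sum>b\<in>(Basis::'a set). (1/2) ^ k)"
    by (rule sum_mono)
  then show ?thesis using norm_le_l1 [of "x - y"] by simp
qed

lemma finite_dyadic_image:
  fixes A :: "'a::euclidean_space set"
  assumes "bounded A" shows "finite (dyadic k ` A)"
proof -
  obtain R where R: "\<And>x. x \<in> A \<Longrightarrow> norm x \<le> R"
    using assms by (auto simp: bounded_iff)
  have "dyadic k ` A \<subseteq> (\<Pi>\<^sub>E b\<in>Basis. {\<lfloor>2 ^ k * - R\<rfloor>..\<lfloor>2 ^ k * R\<rfloor>})"
  proof clarify
    fix x assume "x \<in> A"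
    have "2 ^ k * - R \<le> 2 ^ k * (x \<bullet> b) \<and> 2 ^ k * (x \<bullet> b) \<le> 2 ^ k * R" if "b \<in> Basis" for b
      using Basis_le_norm [OF that, of x] R [OF \<open>x \<in> A\<close>]
      by (intro conjI mult_left_mono) auto
    then show "dyadic k x \<in> (\<Pi>\<^sub>E b\<in>Basis. {\<lfloor>2 ^ k * - R\<rfloor>..\<lfloor>2 ^ k * R\<rfloor>})"
      unfolding dyadic_def restrict_PiE_iff by (auto intro!: floor_mono)
  qed
  then show ?thesis by (rule finite_subset) (simp add: finite_PiE)
qed

text \<open>Moving by at most \<open>(1/2) ^ k\<close> changes each floor by at most one, which
  leaves three values per coordinate.\<close>

lemma dyadic_image_near:
  fixes x :: "'a::euclidean_space" and k :: nat
  defines "D \<equiv> dyadic k ` {y. norm (x - y) \<le> (1/2) ^ k}"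
  shows "finite D" "card D \<le> 3 ^ DIM('a)"
proof -
  let ?E = "\<Pi>\<^sub>E b\<in>Basis. {\<lfloor>2 ^ k * (x \<bullet> b)\<rfloor> - 1..\<lfloor>2 ^ k * (x \<bullet> b)\<rfloor> + 1}"
  have "D \<subseteq> ?E"
    unfolding D_def
  proof clarify
    fix y assume "norm (x - y) \<le> (1/2) ^ k"
    have "\<bar>2 ^ k * (x \<bullet> b) - 2 ^ k * (y \<bullet> b)\<bar> \<le> 1" if "b \<in> Basis" for b
    proof -
      have "\<bar>(x - y) \<bullet> b\<bar> \<le> (1/2) ^ k"
        using Basis_le_norm [OF that, of "x - y"] \<open>norm (x - y) \<le> _\<close> by linarith
      then have "\<bar>2 ^ k * ((x - y) \<bullet> b)\<bar> \<le> 1" by (simp add: abs_mult field_simps)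
      then show ?thesis by (simp add: algebra_simps)
    qed
    then have "\<lfloor>2 ^ k * (x \<bullet> b)\<rfloor> - 1 \<le> \<lfloor>2 ^ k * (y \<bullet> b)\<rfloor> \<and> \<lfloor>2 ^ k * (y \<bullet> b)\<rfloor> \<le> \<lfloor>2 ^ k * (x \<bullet> b)\<rfloor> + 1"
      if "b \<in> Basis" for b
    proof -
      have "\<bar>u - v\<bar> \<le> 1 \<Longrightarrow> \<lfloor>u\<rfloor> - 1 \<le> \<lfloor>v\<rfloor> \<and> \<lfloor>v\<rfloor> \<le> \<lfloor>u\<rfloor> + 1" for u v :: real by linarith
      then show ?thesis using \<open>\<And>b. b \<in> Basis \<Longrightarrow> _\<close> that by blast
    qed
    then show "dyadic k y \<in> ?E" by (simp add: dyadic_def PiE_iff)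
  qed
  have "finite ?E" by (simp add: finite_PiE)
  then show "finite D" by (rule finite_subset [OF \<open>D \<subseteq> ?E\<close>])
  have "card D \<le> card ?E" by (rule card_mono [OF \<open>finite ?E\<close> \<open>D \<subseteq> ?E\<close>])
  also have "card ?E = 3 ^ DIM('a)" by (simp add: card_PiE)
  finally show "card D \<le> 3 ^ DIM('a)" .
qed

section \<open>Dyadic content and Hausdorff measure\<close>

lemma hausdorff_pre_le_countable:
  assumes "countable I" "A \<subseteq> (\<Union>i\<in>I. U i)" "0 \<le> \<delta>"
    and U: "\<And>i. i \<in> I \<Longrightarrow> bounded (U i) \<and> diameter (U i) \<le> \<delta>"
  shows "hausdorff_pre s \<delta> A \<le> (\<integral>\<^sup>+i. diam_pow s (U i) \<partial>count_space I)"
proof -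
  \<comment> \<open>Indices outside the image of \<open>I\<close> receive the empty set, which costs
    nothing even at \<open>s = 0\<close>.\<close>
  define W where "W n = (if n \<in> to_nat_on I ` I then U (from_nat_into I n) else {})" for n
  have "A \<subseteq> (\<Union>n. W n)"
  proof
    fix x assume "x \<in> A"
    then obtain i where "i \<in> I" "x \<in> U i" using assms(2) by auto
    then have "x \<in> W (to_nat_on I i)" using assms(1) by (simp add: W_def)
    then show "x \<in> (\<Union>n. W n)" by blast
  qed
  moreover have "bounded (W n) \<and> diameter (W n) \<le> \<delta>" for n
    using U assms(1,3) by (auto simp: W_def)
  ultimately have "hausdorff_pre s \<delta> A \<le> (\<Sum>n. diam_pow s (W n))"
    unfolding hausdorff_pre_def by (intro INF_lower) auto
  also have "\<dots> = (\<integral>\<^sup>+n. diam_pow s (W n) \<partial>count_space UNIV)"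
    by (simp add: nn_integral_count_space_nat)
  also have "\<dots> = (\<integral>\<^sup>+n. diam_pow s (W n) \<partial>count_space (to_nat_on I ` I))"
    by (rule nn_integral_count_space_eq) (auto simp: W_def diam_pow_def)
  also have "\<dots> = (\<integral>\<^sup>+i. diam_pow s (W (to_nat_on I i)) \<partial>count_space I)"
    using assms(1) by (intro nn_integral_bij_count_space [symmetric] inj_on_imp_bij_betw inj_on_to_nat_on)
  also have "\<dots> = (\<integral>\<^sup>+i. diam_pow s (U i) \<partial>count_space I)"
    using assms(1) by (intro nn_integral_cong) (simp add: W_def)
  finally show ?thesis .
qed

abbreviation dyadic_cost :: "real \<Rightarrow> nat \<Rightarrow> real" where
  "dyadic_cost t k \<equiv> ((1/2) ^ k) powr t"

global_interpretation dyadic: refining_cells dyadic "dyadic_cost t" for t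
  defines dyadic_content = dyadic.content
  by unfold_locales (auto intro: dyadic_refine)

text \<open>A cover of small total cost consists of small cells only, since a single large cell
  would already cost too much. So a vanishing content, although it puts no bound on cell sizes,
  makes the pre-measure vanish at every scale.\<close>

lemma hausdorff_measure_eq_0_of_dyadic_content:
  fixes A :: "'a::euclidean_space set"
  assumes "0 < t" and null: "dyadic_content t A = 0"
  shows "hausdorff_measure t A = 0"
proof -
  have small: "hausdorff_pre t \<delta> A \<le> 0 + ennreal e" if "0 < \<delta>" "0 < e" for \<delta> e :: real
  proof -
    define D where "D = real DIM('a)"
    have "0 < D" by (simp add: D_def)
    \<comment> \<open>The first bound makes \<open>D powr t * r\<close> at most \<open>e\<close>;
      the second gives every cell of cost below \<open>r\<close> a diameter of at most
      \<open>\<delta>\<close>.\<close>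
    define r where "r = min (e / D powr t) ((\<delta> / D) powr t)"
    have "0 < r" using that \<open>0 < D\<close> by (simp add: r_def)
    then have "dyadic_content t A < ennreal r" by (simp add: null)
    then obtain C where C: "A \<subseteq> dyadic.cover C" "dyadic.cost t C < ennreal r"
      unfolding dyadic.content_def INF_less_iff by auto
    \<comment> \<open>Only extensional labels belong to points, and there are countably many of
      them; discarding the others makes the index set countable.\<close>
    define C' :: "(nat \<times> ('a \<Rightarrow> int)) set" where
      "C' = C \<inter> UNIV \<times> (\<Pi>\<^sub>E b\<in>Basis. UNIV)"
    define U :: "nat \<times> ('a \<Rightarrow> int) \<Rightarrow> 'a set" where "U q = {x. dyadic (fst q) x = snd q}" for q
    have "countable C'"
      unfolding C'_def by (intro countable_Int2 countable_SIGMA countable_PiE) auto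
    have small: "dyadic_cost t (fst q) < r" if "q \<in> C" for q
    proof -
      have "ennreal (dyadic_cost t (fst q)) = dyadic.cost t {q}"
        by (subst dyadic.cost_finite) auto
      also have "\<dots> \<le> dyadic.cost t C" using that by (intro dyadic.cost_mono) auto
      also note C(2)
      finally show ?thesis by (simp add: ennreal_less_iff)
    qed
    have dist_U: "norm (x - y) \<le> D * (1/2) ^ fst q" if "x \<in> U q" "y \<in> U q" for x y q
      using norm_diff_le_of_dyadic_eq [of "fst q" x y] that by (simp add: U_def D_def)
    have bdd: "bounded (U q)" for q
    proof (cases "U q = {}")
      case False
      then obtain x where "x \<in> U q" by auto
      then show ?thesis using dist_U [of x q]
        by (intro boundedI [of _ "norm x + D * (1/2) ^ fst q"]) (smt (verit) norm_triangle_sub norm_minus_commute)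
    qed auto
    have diam: "diameter (U q) \<le> D * (1/2) ^ fst q" for q
      using \<open>0 < D\<close> by (intro diameter_le dist_U) auto
    have "hausdorff_pre t \<delta> A \<le> (\<integral>\<^sup>+q. diam_pow t (U q) \<partial>count_space C')"
    proof (rule hausdorff_pre_le_countable)
      show "A \<subseteq> (\<Union>q\<in>C'. U q)"
      proof
        fix x assume "x \<in> A"
        then obtain k where "(k, dyadic k x) \<in> C" using C(1) by (auto simp: dyadic.cover_def)
        then have "(k, dyadic k x) \<in> C'" by (simp add: C'_def dyadic_def)
        then show "x \<in> (\<Union>q\<in>C'. U q)" by (force simp: U_def)
      qed
      fix q assume "q \<in> C'"
      then have "dyadic_cost t (fst q) < (\<delta> / D) powr t" using small by (auto simp: C'_def r_def)
      then have "(1/2) ^ fst q < \<delta> / D"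
        using powr_mono2 [of t "\<delta> / D" "(1/2) ^ fst q"] that \<open>0 < D\<close> \<open>0 < t\<close> by force
      then have "D * (1/2) ^ fst q \<le> \<delta>" using \<open>0 < D\<close> by (simp add: field_simps)
      then show "bounded (U q) \<and> diameter (U q) \<le> \<delta>" using bdd diam [of q] by auto
    qed (use \<open>countable C'\<close> that in auto)
    also have "\<dots> \<le> (\<integral>\<^sup>+q. ennreal (D powr t) * ennreal (dyadic_cost t (fst q)) \<partial>count_space C')"
    proof (rule nn_integral_mono)
      fix q
      have "diameter (U q) powr t \<le> (D * (1/2) ^ fst q) powr t"
        using diam diameter_ge_0 [OF bdd] \<open>0 < t\<close> by (intro powr_mono2) auto
      also have "\<dots> = D powr t * dyadic_cost t (fst q)"
        using \<open>0 < D\<close> by (simp add: powr_mult)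
      finally show "diam_pow t (U q) \<le> ennreal (D powr t) * ennreal (dyadic_cost t (fst q))"
        using \<open>0 < t\<close> by (auto simp: diam_pow_def ennreal_mult [symmetric] intro: ennreal_leI)
    qed
    also have "\<dots> = ennreal (D powr t) * (\<integral>\<^sup>+q. ennreal (dyadic_cost t (fst q)) \<partial>count_space C')"
      by (rule nn_integral_cmult) simp
    also have "(\<integral>\<^sup>+q. ennreal (dyadic_cost t (fst q)) \<partial>count_space C') = dyadic.cost t C'"
      unfolding dyadic.cost_def
      by (subst emeasure_density) (auto simp: nn_integral_count_space_indicator)
    also have "ennreal (D powr t) * dyadic.cost t C' \<le> ennreal (D powr t) * ennreal r"
    proof (rule mult_left_mono)
      have "dyadic.cost t C' \<le> dyadic.cost t C" by (rule dyadic.cost_mono) (auto simp: C'_def)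
      then show "dyadic.cost t C' \<le> ennreal r" using C(2) by simp
    qed simp
    also have "\<dots> \<le> ennreal e"
      using \<open>0 < D\<close> \<open>0 < r\<close>
      by (auto simp: ennreal_mult [symmetric] r_def min_def field_simps intro!: ennreal_leI)
    finally show ?thesis by simp
  qed
  then have "hausdorff_pre t \<delta> A = 0" if "0 < \<delta>" for \<delta>
  proof -
    have "hausdorff_pre t \<delta> A \<le> 0" by (rule ennreal_le_epsilon) (rule small [OF that])
    then show ?thesis by simp
  qed
  then show ?thesis by (auto simp: hausdorff_measure_def)
qed

section \<open>Capacitability of analytic sets\<close>

lemma tendsto_fun_componentwise:
  fixes f :: "'b \<Rightarrow> 'i \<Rightarrow> 'a::topological_space"
  shows "(f \<longlongrightarrow> l) F \<longleftrightarrow> (\<forall>i. ((\<lambda>n. f n i) \<longlongrightarrow> l i) F)"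
  using limitin_componentwise [of "\<lambda>_. euclidean" UNIV f l F]
  by (simp add: euclidean_product_topology)

text \<open>The coordinates of the Baire space are cut one after the other, each at a height that
  keeps the value above \<open>a\<close>; in the limit a compact set of sequences remains. The sets
  \<open>A n\<close> after \<open>n\<close> cuts stay in the conclusion because the discrete
  measures will live on them.\<close>

lemma analytic_set_capacity:
  fixes B :: "'a::real_normed_vector set" and \<Phi> :: "'a set \<Rightarrow> ennreal"
  assumes B: "analytic_set B" and a: "a < \<Phi> B"
    and \<Phi>: "\<And>A. incseq A \<Longrightarrow> \<Phi> (\<Union>i. A i) = (SUP i. \<Phi> (A i))"
  obtains K A where "compact K" "K \<subseteq> B" "\<And>n. a < \<Phi> (A n)" "\<And>n. bounded (A n)"
    "\<And>U. open U \<Longrightarrow> K \<subseteq> U \<Longrightarrow> eventually (\<lambda>n. A n \<subseteq> U) sequentially"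
proof (cases "B = {}")
  case True
  then show ?thesis using a that [of "{}" "\<lambda>_. {}"] by simp
next
  case False
  then obtain f :: "(nat \<Rightarrow> nat) \<Rightarrow> 'a" where f: "continuous_on UNIV f" "B = range f"
    using B by (auto simp: analytic_set_def)
  \<comment> \<open>A first cut by balls of radius \<open>i\<close> makes all later sets bounded, so
    that they will meet only finitely many dyadic cubes of each level.\<close>
  have "(\<Union>i::nat. f ` (f -` cball 0 (real i))) = B"
  proof
    show "B \<subseteq> (\<Union>i::nat. f ` (f -` cball 0 (real i)))"
    proof
      fix y assume "y \<in> B"
      moreover obtain i :: nat where "norm y \<le> real i" using real_arch_simple by blast
      ultimately show "y \<in> (\<Union>i::nat. f ` (f -` cball 0 (real i)))" using f(2) by force
    qed
  qed (use f in auto)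
  moreover have "incseq (\<lambda>i::nat. f ` (f -` cball 0 (real i)))"
    by (rule incseq_SucI) auto
  ultimately have "a < (SUP i::nat. \<Phi> (f ` (f -` cball 0 (real i))))"
    using a \<Phi> by metis
  then obtain R :: nat where R: "a < \<Phi> (f ` (f -` cball 0 (real R)))"
    by (auto simp: less_SUP_iff)
  define F where "F = f -` cball 0 (real R)"
  have "closed F" unfolding F_def by (rule closed_vimage [OF closed_cball f(1)])
  have step: "\<exists>m. a < \<Phi> (f ` (S \<inter> {x. x k \<le> m}))" if "a < \<Phi> (f ` S)" for S and k :: nat
  proof -
    have "(\<Union>m::nat. f ` (S \<inter> {x. x k \<le> m})) = f ` S" by auto
    moreover have "incseq (\<lambda>m::nat. f ` (S \<inter> {x. x k \<le> m}))" by (rule incseq_SucI) auto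
    ultimately have "a < (SUP m. \<Phi> (f ` (S \<inter> {x. x k \<le> m})))" using that \<Phi> by metis
    then show ?thesis by (auto simp: less_SUP_iff)
  qed
  have "\<exists>S. \<forall>k. (a < \<Phi> (f ` S k) \<and> (k = 0 \<longrightarrow> S k = F)) \<and> (\<exists>m. S (Suc k) = S k \<inter> {x. x k \<le> m})"
  proof (rule dependent_nat_choice)
    show "\<exists>S. a < \<Phi> (f ` S) \<and> (0 = (0::nat) \<longrightarrow> S = F)" using R by (auto simp: F_def)
    fix S and k :: nat assume "a < \<Phi> (f ` S) \<and> (k = 0 \<longrightarrow> S = F)"
    then obtain m where "a < \<Phi> (f ` (S \<inter> {x. x k \<le> m}))" using step by blast
    then show "\<exists>T. (a < \<Phi> (f ` T) \<and> (Suc k = 0 \<longrightarrow> T = F)) \<and> (\<exists>m. T = S \<inter> {x. x k \<le> m})"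
      by blast
  qed
  then obtain S where S: "\<And>k. a < \<Phi> (f ` S k)" "S 0 = F"
    and ex_m: "\<And>k. \<exists>m. S (Suc k) = S k \<inter> {x. x k \<le> m}" by blast
  from ex_m obtain m where m: "\<And>k. S (Suc k) = S k \<inter> {x. x k \<le> m k}" by metis
  have S_eq: "S k = {x \<in> F. \<forall>i<k. x i \<le> m i}" for k
    by (induction k) (auto simp: S m less_Suc_eq)
  define D where "D = {x::nat \<Rightarrow> nat. \<forall>i. x i \<le> m i}"
  have "compactin (product_topology (\<lambda>i. euclidean) UNIV) (\<Pi>\<^sub>E i\<in>UNIV. {..m i})"
    by (simp add: compactin_PiE finite_imp_compact)
  also have "(\<Pi>\<^sub>E i\<in>UNIV. {..m i}) = D" by (auto simp: D_def)
  finally have "compact D" by (simp add: euclidean_product_topology)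
  define K where "K = f ` (D \<inter> F)"
  have "compact K" unfolding K_def
    using \<open>compact D\<close> \<open>closed F\<close> f(1)
    by (intro compact_continuous_image compact_Int_closed) (auto intro: continuous_on_subset)
  moreover have "K \<subseteq> B" by (auto simp: K_def f)
  moreover have "bounded (f ` S n)" for n
    by (rule bounded_subset [of "cball 0 (real R)"]) (auto simp: S_eq F_def)
  moreover have "eventually (\<lambda>n. f ` S n \<subseteq> U) sequentially" if "open U" "K \<subseteq> U" for U
  proof (rule ccontr)
    assume not: "\<not> eventually (\<lambda>n. f ` S n \<subseteq> U) sequentially"
    \<comment> \<open>The sets \<open>S k\<close> decrease, so a failure at a later \<open>k\<close>
      gives a point of \<open>S n\<close>.\<close>
    have "\<exists>x. x \<in> S n \<and> f x \<notin> U" for n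
    proof -
      obtain k where "n \<le> k" "\<not> f ` S k \<subseteq> U"
        using not unfolding eventually_sequentially by blast
      then show ?thesis by (auto simp: S_eq intro: less_le_trans)
    qed
    then obtain X where X: "\<And>n. X n \<in> S n" "\<And>n. f (X n) \<notin> U" by metis
    \<comment> \<open>\<open>X n\<close> itself may lie outside \<open>D\<close>, as only its first
      \<open>n\<close> coordinates are controlled. Filling up with zeros gives points of the compact
      set \<open>D\<close>, and any fixed coordinate of \<open>X n\<close> and \<open>Y n\<close>
      agrees for large \<open>n\<close>, so limits carry over.\<close>
    define Y where "Y n = (\<lambda>i. if i < n then X n i else 0)" for n
    have "Y n \<in> D" for n using X(1)[of n] by (auto simp: Y_def D_def S_eq)
    then obtain l r where l: "l \<in> D" "strict_mono (r :: nat \<Rightarrow> nat)" "(Y \<circ> r) \<longlonglongrightarrow> l"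
      using compact_imp_seq_compact [OF \<open>compact D\<close>] by (metis seq_compactE)
    have lim: "(X \<circ> r) \<longlonglongrightarrow> l"
      unfolding tendsto_fun_componentwise
    proof
      fix i
      have "(\<lambda>n. (Y \<circ> r) n i) \<longlonglongrightarrow> l i" using l(3) by (simp only: tendsto_fun_componentwise)
      moreover have "eventually (\<lambda>n. (Y \<circ> r) n i = (X \<circ> r) n i) sequentially"
        using eventually_gt_at_top [of i]
        by eventually_elim (use seq_suble [OF l(2)] in \<open>auto simp: Y_def intro: less_le_trans\<close>)
      ultimately show "(\<lambda>n. (X \<circ> r) n i) \<longlonglongrightarrow> l i" by (rule Lim_transform_eventually)
    qed
    have "l \<in> F"
      by (rule closed_sequentially [OF \<open>closed F\<close> _ lim]) (use X in \<open>auto simp: S_eq\<close>)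
    then have "f l \<in> U" using l(1) that by (auto simp: K_def)
    moreover have "(f \<circ> (X \<circ> r)) \<longlonglongrightarrow> f l"
      unfolding comp_def by (rule continuous_on_tendsto_compose [OF f(1)]) (use lim in \<open>simp_all add: comp_def\<close>)
    then have "f l \<in> - U"
      by (rule closed_sequentially [rotated 2]) (use X that in auto)
    ultimately show False by simp
  qed
  ultimately show thesis using that [of K "\<lambda>n. f ` S n"] S(1) by blast
qed

section \<open>Subspaces near lattice points\<close>

text \<open>Gaussian elimination with pivot coordinates \<open>I\<close>. Choosing the largest
  coordinate as pivot bounds the norms in terms of the dimensions only, uniformly in
  \<open>V\<close>.\<close>

lemma subspace_pivots:
  fixes V :: "'a::euclidean_space set"
  assumes "subspace V" "dim V = k"
  shows "\<exists>I v. I \<subseteq> Basis \<and> card I = k \<and> (\<forall>i\<in>I. v i \<in> V \<and> norm (v i) \<le> (1 + DIM('a)) ^ k) \<and>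
    (\<forall>i\<in>I. \<forall>j\<in>I. v i \<bullet> j = (if i = j then 1 else 0))"
  using assms
proof (induction k arbitrary: V)
  case 0
  show ?case by (intro exI[of _ "{}"]) simp
next
  case (Suc k)
  define d where "d = real DIM('a)"
  obtain V' where V': "subspace V'" "V' \<subseteq> V" "dim V' = k"
  proof (rule choose_subspace_of_subspace [of k V])
    show "k \<le> dim V" using Suc.prems by simp
    fix T assume "subspace T" "T \<subseteq> span V" "dim T = k"
    moreover have "span V = V" using Suc.prems by (simp add: span_eq_iff)
    ultimately show thesis using that by simp
  qed
  from Suc.IH [OF V'(1,3)] obtain I v where
    IH: "I \<subseteq> Basis \<and> card I = k \<and> (\<forall>i\<in>I. v i \<in> V' \<and> norm (v i) \<le> (1 + DIM('a)) ^ k) \<and>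
      (\<forall>i\<in>I. \<forall>j\<in>I. v i \<bullet> j = (if i = j then 1 else 0))"
    by (elim exE)
  then have I: "I \<subseteq> Basis" "card I = k"
    and v: "\<And>i. i \<in> I \<Longrightarrow> v i \<in> V'" "\<And>i. i \<in> I \<Longrightarrow> norm (v i) \<le> (1 + d) ^ k"
    and delta: "\<And>i j. i \<in> I \<Longrightarrow> j \<in> I \<Longrightarrow> v i \<bullet> j = (if i = j then 1 else 0)"
    by (auto simp: d_def)
  have "finite I" using I(1) finite_Basis finite_subset by blast
  obtain w where w: "w \<in> V" "w \<notin> V'" using V' Suc.prems by (cases "V \<subseteq> V'") auto
  \<comment> \<open>Clearing the old pivot coordinates leaves a nonzero vector because
    \<open>w\<close> is outside \<open>V'\<close>.\<close>
  define w' where "w' = w - (\<Sum>i\<in>I. (w \<bullet> i) *\<^sub>R v i)"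
  have comb: "(\<Sum>i\<in>I. (w \<bullet> i) *\<^sub>R v i) \<in> V'"
    using v V' by (intro subspace_sum subspace_scale) auto
  have "w' \<in> V" unfolding w'_def using w comb V' Suc.prems by (intro subspace_diff) auto
  have "w' \<noteq> 0" using w(2) comb by (auto simp: w'_def)
  have w'_I: "w' \<bullet> j = 0" if "j \<in> I" for j
  proof -
    have "(\<Sum>i\<in>I. (w \<bullet> i) *\<^sub>R v i) \<bullet> j = (\<Sum>i\<in>I. if i = j then w \<bullet> i else 0)"
      unfolding inner_sum_left using that by (intro sum.cong) (auto simp: delta)
    also have "\<dots> = w \<bullet> j" using that \<open>finite I\<close> by simp
    finally show ?thesis by (simp add: w'_def inner_diff_left)
  qed
  \<comment> \<open>The pivot is the largest coordinate, so after division all coordinates have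
    modulus at most 1 and \<open>norm u \<le> d\<close>.\<close>
  define M where "M = Max ((\<lambda>b. \<bar>w' \<bullet> b\<bar>) ` Basis)"
  have "M \<in> (\<lambda>b. \<bar>w' \<bullet> b\<bar>) ` Basis" unfolding M_def by (intro Max_in) auto
  then obtain b where b: "b \<in> Basis" "\<bar>w' \<bullet> b\<bar> = M" by auto
  have b_max: "\<bar>w' \<bullet> c\<bar> \<le> \<bar>w' \<bullet> b\<bar>" if "c \<in> Basis" for c
    unfolding b(2) M_def using that by (intro Max_ge) auto
  have "w' \<bullet> b \<noteq> 0"
    using \<open>w' \<noteq> 0\<close> b_max by (metis abs_le_zero_iff abs_zero euclidean_all_zero_iff)
  then have "b \<notin> I" using w'_I by auto
  define u where "u = w' /\<^sub>R (w' \<bullet> b)"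
  have "u \<in> V" unfolding u_def using \<open>w' \<in> V\<close> Suc.prems by (intro subspace_scale)
  have u_I: "u \<bullet> j = 0" if "j \<in> I" for j using w'_I[OF that] by (simp add: u_def)
  have u_b: "u \<bullet> b = 1" using \<open>w' \<bullet> b \<noteq> 0\<close> by (simp add: u_def)
  have "norm u \<le> d"
  proof -
    have "(\<Sum>c\<in>Basis. \<bar>u \<bullet> c\<bar>) \<le> (\<Sum>c\<in>(Basis::'a set). 1)"
    proof (rule sum_mono)
      fix c :: 'a assume "c \<in> Basis"
      then show "\<bar>u \<bullet> c\<bar> \<le> 1"
        using b_max[of c] \<open>w' \<bullet> b \<noteq> 0\<close> by (simp add: u_def abs_mult field_simps)
    qed
    then show ?thesis using norm_le_l1 [of u] by (simp add: d_def)
  qed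
  have "0 \<le> d" by (simp add: d_def)
  \<comment> \<open>The old vectors lose their coordinate at the new pivot \<open>b\<close>, at the
    price of a factor \<open>1 + d\<close> in the norm.\<close>
  define v' where "v' i = (if i = b then u else v i - (v i \<bullet> b) *\<^sub>R u)" for i
  have "norm (v' i) \<le> (1 + d) ^ Suc k" if "i \<in> insert b I" for i
  proof (cases "i = b")
    case True
    have "d \<le> (1 + d) * 1" by simp
    also have "\<dots> \<le> (1 + d) * (1 + d) ^ k" using \<open>0 \<le> d\<close> by (intro mult_left_mono one_le_power) auto
    finally show ?thesis using \<open>norm u \<le> d\<close> True by (simp add: v'_def)
  next
    case False
    then have "i \<in> I" using that by simp
    have "norm (v' i) \<le> norm (v i) + \<bar>v i \<bullet> b\<bar> * norm u"
      using False norm_triangle_ineq4 [of "v i" "(v i \<bullet> b) *\<^sub>R u"] by (simp add: v'_def)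
    also have "\<dots> \<le> norm (v i) + norm (v i) * d"
      using \<open>norm u \<le> d\<close> Basis_le_norm [OF b(1)] by (intro add_left_mono mult_mono) auto
    also have "\<dots> = norm (v i) * (1 + d)" by (simp add: algebra_simps)
    also have "\<dots> \<le> (1 + d) ^ k * (1 + d)"
      using v(2)[OF \<open>i \<in> I\<close>] \<open>0 \<le> d\<close> by (intro mult_right_mono) auto
    finally show ?thesis by (simp add: mult.commute)
  qed
  moreover have "v' i \<in> V" if "i \<in> insert b I" for i
    using that v(1) V' \<open>u \<in> V\<close> Suc.prems(1)
    by (auto simp: v'_def intro!: subspace_diff subspace_scale)
  moreover have "v' i \<bullet> j = (if i = j then 1 else 0)" if "i \<in> insert b I" "j \<in> insert b I" for i j
    using that \<open>b \<notin> I\<close> u_I u_b delta by (auto simp: v'_def inner_diff_left)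
  ultimately show ?case
    using I b(1) \<open>b \<notin> I\<close> \<open>finite I\<close> unfolding d_def
    by (intro exI[of _ "insert b I"] exI[of _ v'] conjI ballI) (simp_all del: power_Suc)
qed

lemma card_int_interval_le:
  fixes a r :: real
  assumes "0 \<le> r"
  shows "finite {z::int. \<bar>of_int z + a\<bar> \<le> r}" "card {z::int. \<bar>of_int z + a\<bar> \<le> r} \<le> 2 * r + 1"
proof -
  have *: "{z::int. \<bar>of_int z + a\<bar> \<le> r} = {\<lceil>- r - a\<rceil>..\<lfloor>r - a\<rfloor>}"
    by (auto simp: abs_le_iff ceiling_le_iff le_floor_iff)
  show "finite {z::int. \<bar>of_int z + a\<bar> \<le> r}" unfolding * by simp
  have "real (nat (\<lfloor>r - a\<rfloor> + 1 - \<lceil>- r - a\<rceil>)) \<le> 2 * r + 1" using assms by linarith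
  then show "card {z::int. \<bar>of_int z + a\<bar> \<le> r} \<le> 2 * r + 1" unfolding * by simp
qed

definition lattice_point :: "('a::euclidean_space \<Rightarrow> int) \<Rightarrow> 'a" where
  "lattice_point x = (\<Sum>b\<in>Basis. of_int (x b) *\<^sub>R b)"

text \<open>By \<open>delta\<close>, the inner product of \<open>lattice_point x\<close> with
  \<open>v i\<close> is \<open>x i\<close> plus a term in the non-pivot coordinates. These take
  \<open>m\<close> values each; once they are fixed, each pivot coordinate lies in an interval of
  length \<open>2 * r\<close>.\<close>

lemma card_lattice_slab_le:
  fixes v :: "'a::euclidean_space \<Rightarrow> 'a" and m :: nat and r :: real
  assumes I: "I \<subseteq> Basis" and "0 \<le> r"
    and delta: "\<And>i j. i \<in> I \<Longrightarrow> j \<in> I \<Longrightarrow> v i \<bullet> j = (if i = j then 1 else 0)"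
  shows "card {x \<in> \<Pi>\<^sub>E b\<in>Basis. {1..int m}. \<forall>i\<in>I. \<bar>lattice_point x \<bullet> v i\<bar> \<le> r}
    \<le> real m ^ (DIM('a) - card I) * (2 * r + 1) ^ card I" (is "real (card ?S) \<le> _")
proof -
  let ?J = "Basis - I"
  have [simp]: "finite I" using I finite_Basis finite_subset by blast
  define Y where "Y = (\<Pi>\<^sub>E b\<in>?J. {1..int m})"
  define T where "T y = (\<Pi>\<^sub>E i\<in>I. {z::int. \<bar>of_int z + (\<Sum>b\<in>?J. of_int (y b) * (b \<bullet> v i))\<bar> \<le> r})" for y
  have "finite Y" by (simp add: Y_def finite_PiE)
  have finT: "finite (T y)" for y
    unfolding T_def using card_int_interval_le(1)[OF \<open>0 \<le> r\<close>] by (intro finite_PiE) auto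
  have inner: "lattice_point x \<bullet> v i = of_int (x i) + (\<Sum>b\<in>?J. of_int (x b) * (b \<bullet> v i))"
    if "i \<in> I" for x i
  proof -
    have "lattice_point x \<bullet> v i = (\<Sum>b\<in>Basis. of_int (x b) * (b \<bullet> v i))"
      by (simp add: lattice_point_def inner_sum_left)
    also have "\<dots> = (\<Sum>b\<in>?J. of_int (x b) * (b \<bullet> v i)) + (\<Sum>b\<in>I. of_int (x b) * (b \<bullet> v i))"
      using I by (intro sum.subset_diff) auto
    also have "(\<Sum>b\<in>I. of_int (x b) * (b \<bullet> v i)) = (\<Sum>b\<in>I. if b = i then of_int (x i) else 0)"
      using that by (intro sum.cong) (auto simp: inner_commute [of _ "v i"] delta)
    also have "\<dots> = of_int (x i)" using that by simp
    finally show ?thesis by simp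
  qed
  define F where "F x = (restrict x ?J, restrict x I)" for x :: "'a \<Rightarrow> int"
  have "inj_on F ?S"
  proof (rule inj_onI)
    fix x y assume x: "x \<in> ?S" and y: "y \<in> ?S" and eq: "F x = F y"
    have "restrict x ?J = restrict y ?J" "restrict x I = restrict y I"
      using eq by (auto simp: F_def)
    then have "x b = y b" if "b \<in> Basis" for b
      using that by (cases "b \<in> I") (metis restrict_apply' DiffI)+
    with x y show "x = y" by (auto intro: PiE_ext)
  qed
  moreover have "F ` ?S \<subseteq> Sigma Y T"
  proof
    fix p assume "p \<in> F ` ?S"
    then obtain x where x: "x \<in> ?S" "p = F x" by auto
    have "restrict x ?J \<in> Y" using x(1) by (auto simp: Y_def)
    moreover have "restrict x I \<in> T (restrict x ?J)"
      using x(1) by (auto simp: T_def inner)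
    ultimately show "p \<in> Sigma Y T" by (simp add: x(2) F_def)
  qed
  ultimately have "card ?S \<le> card (Sigma Y T)"
    by (intro card_inj_on_le) (use \<open>finite Y\<close> finT in auto)
  also have "card (Sigma Y T) = (\<Sum>y\<in>Y. card (T y))"
    using \<open>finite Y\<close> finT by (intro card_SigmaI) auto
  finally have "real (card ?S) \<le> real (\<Sum>y\<in>Y. card (T y))" by (simp only: of_nat_le_iff)
  also have "real (\<Sum>y\<in>Y. card (T y)) = (\<Sum>y\<in>Y. real (card (T y)))" by simp
  also have "\<dots> \<le> (\<Sum>y\<in>Y. (2 * r + 1) ^ card I)"
  proof (rule sum_mono)
    fix y
    have "real (card (T y)) = (\<Prod>i\<in>I. real (card {z::int. \<bar>of_int z + (\<Sum>b\<in>?J. of_int (y b) * (b \<bullet> v i))\<bar> \<le> r}))"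
      unfolding T_def by (simp add: card_PiE)
    also have "\<dots> \<le> (\<Prod>i\<in>I. 2 * r + 1)"
      by (intro prod_mono conjI card_int_interval_le(2) \<open>0 \<le> r\<close>) auto
    finally show "real (card (T y)) \<le> (2 * r + 1) ^ card I" by simp
  qed
  also have "\<dots> = real (card Y) * (2 * r + 1) ^ card I" by simp
  also have "card Y = m ^ (DIM('a) - card I)"
    using I by (simp add: Y_def card_PiE card_Diff_subset)
  finally show ?thesis by simp
qed

section \<open>Projections onto random subspaces\<close>

lemma inner_orth_proj:
  assumes "subspace V" "v \<in> V" shows "orth_proj V x \<bullet> v = x \<bullet> v"
  using orth_proj_inner [OF assms, of x] by (simp add: inner_diff_left)

lemma norm_orth_proj_le:
  assumes "subspace V" shows "norm (orth_proj V x) \<le> norm x"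
proof -
  have "orth_proj V x \<bullet> orth_proj V x = x \<bullet> orth_proj V x"
    by (intro inner_orth_proj assms orth_proj_mem)
  also have "\<dots> \<le> norm x * norm (orth_proj V x)" by (rule norm_cauchy_schwarz)
  finally show ?thesis
    by (cases "orth_proj V x = 0") (simp_all add: dot_square_norm power2_eq_square)
qed

lemma orth_proj_scaleR: "subspace V \<Longrightarrow> orth_proj V (c *\<^sub>R x) = c *\<^sub>R orth_proj V x"
  by (rule linear_scale [OF bounded_linear.linear [OF bounded_linear_orth_proj]])

lemma orth_proj_diff: "subspace V \<Longrightarrow> orth_proj V (x - y) = orth_proj V x - orth_proj V y"
  by (rule linear_diff [OF bounded_linear.linear [OF bounded_linear_orth_proj]])

lemma orth_proj_orthogonal_image:
  assumes "orthogonal_transformation g" "subspace V"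
  shows "orth_proj (g ` V) (g x) = g (orth_proj V x)"
proof (rule orth_proj_eqI)
  have lin: "linear g" using assms by (simp add: orthogonal_transformation_linear)
  then show "subspace (g ` V)" using assms by (simp add: linear_subspace_image)
  show "g (orth_proj V x) \<in> g ` V" using assms by (simp add: orth_proj_mem)
  fix w assume "w \<in> g ` V"
  then obtain v where v: "v \<in> V" "w = g v" by auto
  then have "(g x - g (orth_proj V x)) \<bullet> w = g (x - orth_proj V x) \<bullet> g v"
    using lin by (simp add: linear_diff)
  also have "\<dots> = 0"
    using assms v by (simp add: orthogonal_transformation_def orth_proj_inner)
  finally show "(g x - g (orth_proj V x)) \<bullet> w = 0" .
qed

text \<open>The metric is the operator norm of the difference of projections, so evaluation at
  \<open>x\<close> is Lipschitz and hence continuous.\<close>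

lemma borel_measurable_orth_proj:
  fixes \<gamma> :: "'a::euclidean_space set measure"
  assumes "invariant_grassmann_measure k \<gamma>"
  shows "(\<lambda>V. orth_proj V x) \<in> borel_measurable \<gamma>"
proof (rule borel_measurableI)
  interpret Metric_space "grassmannian k :: 'a set set" grassmann_dist
    by (rule Metric_space_grassmannian)
  have sp: "space \<gamma> = grassmannian k" and st: "sets \<gamma> = sets (grassmann_borel k)"
    using assms by (auto simp: invariant_grassmann_measure_def)
  fix S :: "'a set" assume "open S"
  let ?U = "(\<lambda>V. orth_proj V x) -` S \<inter> grassmannian k"
  have "openin mtopology ?U"
    unfolding openin_mtopology
  proof (intro conjI allI impI)
    fix V assume V: "V \<in> ?U"
    then obtain e where e: "0 < e" "\<And>y. dist y (orth_proj V x) < e \<Longrightarrow> y \<in> S"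
      using \<open>open S\<close> by (auto simp: open_dist)
    \<comment> \<open>\<open>norm x + 1\<close> in place of \<open>norm x\<close> avoids a division
      by zero.\<close>
    have "mball V (e / (norm x + 1)) \<subseteq> ?U"
    proof
      fix W assume W: "W \<in> mball V (e / (norm x + 1))"
      then have "V \<in> grassmannian k" "W \<in> grassmannian k" by auto
      then have sub: "subspace V" "subspace W" by (auto simp: grassmannian_def)
      have "norm (orth_proj V x - orth_proj W x) \<le> grassmann_dist V W * norm x"
        using onorm [OF bounded_linear_sub [OF bounded_linear_orth_proj [OF sub(1)] bounded_linear_orth_proj [OF sub(2)]], of x]
        sub by (simp add: grassmann_dist_def)
      also have "\<dots> \<le> grassmann_dist V W * (norm x + 1)"
        by (intro mult_left_mono) auto
      also have "\<dots> < e" using W by (simp add: in_mball pos_less_divide_eq add_nonneg_pos)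
      finally show "W \<in> ?U"
        using e(2)[of "orth_proj W x"] W by (simp add: dist_norm norm_minus_commute in_mball)
    qed
    then show "\<exists>r>0. mball V r \<subseteq> ?U"
      using e(1) by (intro exI[of _ "e / (norm x + 1)"]) (simp add: add_nonneg_pos)
  qed auto
  moreover have "{U. openin mtopology U} \<subseteq> Pow (grassmannian k)"
    by (auto simp: openin_mtopology)
  ultimately show "(\<lambda>V. orth_proj V x) -` S \<inter> space \<gamma> \<in> sets \<gamma>"
    unfolding st grassmann_borel_def sp by (simp add: sets_measure_of sigma_sets.Basic)
qed

section \<open>Dyadic decomposition of the kernel\<close>

lemma half_power_eq_powr: "(1/2::real) ^ p = 2 powr - real p"
  by (simp add: powr_minus powr_realpow power_one_over inverse_eq_divide)

text \<open>If \<open>p\<close> is the last index up to \<open>K\<close> with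
  \<open>\<rho> \<le> (1/2) ^ p\<close>, then \<open>\<rho> \<ge> (1/2) ^ (p + 1)\<close>, so the
  summand at \<open>p\<close> alone dominates. The 1 covers \<open>\<rho> > 1\<close>, and the lower
  bound on \<open>\<rho>\<close> settles \<open>p = K\<close>.\<close>

lemma dyadic_powr_bound:
  fixes \<rho> s :: real
  assumes "(1/2) ^ K \<le> \<rho>" "0 \<le> s"
  shows "\<rho> powr - s \<le> 1 + (\<Sum>p\<le>K. 2 powr (s * (real p + 1)) * of_bool (\<rho> \<le> (1/2) ^ p))"
proof (cases "\<rho> \<le> 1")
  case False
  then have "\<rho> powr - s \<le> 1" using \<open>0 \<le> s\<close> by (simp add: powr_minus ge_one_powr_ge_zero field_simps)
  moreover have "0 \<le> (\<Sum>p\<le>K. 2 powr (s * (real p + 1)) * of_bool (\<rho> \<le> (1/2) ^ p))"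
    by (intro sum_nonneg) auto
  ultimately show ?thesis by linarith
next
  case True
  have "0 < \<rho>" using assms(1) by (rule less_le_trans [rotated]) simp
  define p where "p = (GREATEST p. p \<le> K \<and> \<rho> \<le> (1/2) ^ p)"
  have p: "p \<le> K \<and> \<rho> \<le> (1/2) ^ p"
    unfolding p_def by (rule GreatestI_nat [of _ 0 K]) (use True in auto)
  have "(1/2) ^ (p + 1) \<le> \<rho>"
  proof (cases "p = K")
    case True
    have "(1/2::real) ^ (K + 1) \<le> (1/2) ^ K" by simp
    then show ?thesis unfolding True using assms(1) by (rule order_trans)
  next
    case False
    then have "\<not> \<rho> \<le> (1/2) ^ (p + 1)"
      using Greatest_le_nat [of "\<lambda>p. p \<le> K \<and> \<rho> \<le> (1/2) ^ p" "p + 1" K] p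
      by (auto simp: p_def [symmetric])
    then show ?thesis by simp
  qed
  then have "\<rho> powr - s \<le> ((1/2) ^ (p + 1)) powr - s"
    using \<open>0 \<le> s\<close> \<open>0 < \<rho>\<close> by (intro powr_mono2') auto
  also have "(1/2::real) ^ (p + 1) = 2 powr - (real p + 1)"
    by (simp only: half_power_eq_powr of_nat_add of_nat_1)
  also have "(2 powr - (real p + 1)) powr - s = 2 powr (s * (real p + 1))"
    by (simp add: powr_powr algebra_simps)
  also have "\<dots> \<le> (\<Sum>p\<le>K. 2 powr (s * (real p + 1)) * of_bool (\<rho> \<le> (1/2) ^ p))"
    using p member_le_sum [of p "{..K}" "\<lambda>p. 2 powr (s * (real p + 1)) * of_bool (\<rho> \<le> (1/2) ^ p)"]
    by simp
  finally show ?thesis by simp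
qed

text \<open>A geometric series of ratio \<open>2 powr (s - t)\<close>. It serves twice: with the
  Frostman exponent \<open>t\<close> for the energies, and with \<open>t = k\<close> for the average
  over subspaces.\<close>

lemma dyadic_powr_sum_le:
  fixes s t :: real
  assumes "s < t"
  shows "(\<Sum>p\<le>K. 2 powr (s * (real p + 1)) * ((1/2) ^ p) powr t) \<le> 2 powr s / (1 - 2 powr (s - t))"
proof -
  define x where "x = 2 powr (s - t)"
  have x: "0 < x" "x < 1" using assms by (auto simp: x_def powr_less_one)
  have "2 powr (s * (real p + 1)) * ((1/2) ^ p) powr t = 2 powr s * x ^ p" for p
  proof -
    show ?thesis
      by (simp add: half_power_eq_powr x_def powr_powr powr_add [symmetric] powr_realpow [symmetric] algebra_simps)
  qed
  then have "(\<Sum>p\<le>K. 2 powr (s * (real p + 1)) * ((1/2) ^ p) powr t) = 2 powr s * (\<Sum>p\<le>K. x ^ p)"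
    by (simp add: sum_distrib_left)
  also have "(\<Sum>p\<le>K. x ^ p) \<le> 1 / (1 - x)"
    using x sum_le_suminf [of "\<lambda>p. x ^ p" "{..K}"] suminf_geometric [of x] by (simp add: summable_geometric)
  finally show ?thesis by (simp add: x_def mult_left_mono)
qed

text \<open>Origin of the factors: pivot vectors have norm at most \<open>(1 + d) ^ k\<close>,
  lattice points of a cube of side \<open>m\<close> have norm at most \<open>d * m\<close>, and an
  interval of radius \<open>r\<close> has length \<open>2 * r\<close>.\<close>

definition slab_const :: "nat \<Rightarrow> nat \<Rightarrow> real" where
  "slab_const d k = 2 * (1 + real d) ^ k * real d"

lemma slab_const_nonneg: "0 \<le> slab_const d k"
  by (simp add: slab_const_def)

section \<open>Invariant measure of slabs and averages of projected kernels\<close>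

context
  fixes k :: nat and \<gamma> :: "(real ^ 'p) set measure"
  assumes \<gamma>: "invariant_grassmann_measure k \<gamma>"
begin

lemma space_grassmann: "space \<gamma> = grassmannian k"
  using \<gamma> by (simp add: invariant_grassmann_measure_def)

lemma finite_measure_grassmann: "finite_measure \<gamma>"
  and measure_space_grassmann: "measure \<gamma> (space \<gamma>) = 1"
  using \<gamma> by (auto intro!: finite_measureI simp: invariant_grassmann_measure_def measure_def)

lemma emeasure_grassmann_image:
  "orthogonal_transformation g \<Longrightarrow> A \<in> sets \<gamma> \<Longrightarrow> emeasure \<gamma> ((\<lambda>V. g ` V) ` A) = emeasure \<gamma> A"
  using \<gamma> by (simp add: invariant_grassmann_measure_def)

lemma borel_measurable_norm_orth_proj [measurable]:
  "(\<lambda>V. norm (orth_proj V x)) \<in> borel_measurable \<gamma>"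
  using borel_measurable_orth_proj [OF \<gamma>] by simp

text \<open>Some orthogonal map takes \<open>u\<close> to \<open>u'\<close> and carries the first
  set into the second. Exchanging \<open>u\<close> and \<open>u'\<close> yields equality.\<close>

lemma emeasure_slab_mono:
  assumes "norm u = norm u'"
  shows "emeasure \<gamma> {V \<in> space \<gamma>. norm (orth_proj V u) \<le> r} \<le> emeasure \<gamma> {V \<in> space \<gamma>. norm (orth_proj V u') \<le> r}"
    (is "emeasure \<gamma> ?A \<le> emeasure \<gamma> ?A'")
proof -
  obtain g where g: "orthogonal_transformation g" "g u = u'"
    using orthogonal_transformation_exists [OF assms] .
  have lin: "linear g" and inj: "inj g"
    using g by (auto simp: orthogonal_transformation_linear orthogonal_transformation_inj)
  have "?A \<in> sets \<gamma>" by measurable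
  then have "emeasure \<gamma> ?A = emeasure \<gamma> ((\<lambda>V. g ` V) ` ?A)"
    by (rule emeasure_grassmann_image [OF g(1), symmetric])
  also have "(\<lambda>V. g ` V) ` ?A \<subseteq> ?A'"
  proof clarify
    fix V assume V: "V \<in> space \<gamma>" "norm (orth_proj V u) \<le> r"
    then have "subspace V" "dim V = k" by (auto simp: space_grassmann grassmannian_def)
    then have "g ` V \<in> grassmannian k"
      using lin inj by (simp add: grassmannian_def linear_subspace_image dim_image_eq inj_on_subset [OF inj])
    moreover have "norm (orth_proj (g ` V) u') = norm (orth_proj V u)"
      using orth_proj_orthogonal_image [OF g(1) \<open>subspace V\<close>, of u] g
      by (simp add: orthogonal_transformation_norm)
    ultimately show "g ` V \<in> space \<gamma> \<and> norm (orth_proj (g ` V) u') \<le> r"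
      using V by (simp add: space_grassmann)
  qed
  then have "emeasure \<gamma> ((\<lambda>V. g ` V) ` ?A) \<le> emeasure \<gamma> ?A'"
    by (rule emeasure_mono) measurable
  finally show ?thesis .
qed

text \<open>Subspaces almost orthogonal to \<open>u\<close>. The width is relative to
  \<open>norm u\<close>, so only the direction of \<open>u\<close> matters; for \<open>u = 0\<close>
  the slab is the whole space.\<close>

definition slab :: "real \<Rightarrow> real ^ 'p \<Rightarrow> (real ^ 'p) set set" where
  "slab \<delta> u = {V \<in> space \<gamma>. norm (orth_proj V u) \<le> \<delta> * norm u}"

lemma slab_sets [measurable]: "slab \<delta> u \<in> sets \<gamma>"
  unfolding slab_def by measurable

lemma emeasure_slab_eq:
  assumes "u \<noteq> 0" "u' \<noteq> 0"
  shows "emeasure \<gamma> (slab \<delta> u) = emeasure \<gamma> (slab \<delta> u')"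
proof -
  have unit: "slab \<delta> u = {V \<in> space \<gamma>. norm (orth_proj V (u /\<^sub>R norm u)) \<le> \<delta>}" if "u \<noteq> 0" for u
    using that by (auto simp: slab_def space_grassmann grassmannian_def orth_proj_scaleR field_simps)
  show ?thesis unfolding unit [OF assms(1)] unit [OF assms(2)]
    by (intro antisym emeasure_slab_mono) (use assms in auto)
qed

text \<open>Averaging over the lattice points of a large cube reduces the estimate to counting the points
  of the cube close to the orthogonal complement of a fixed subspace.\<close>

lemma integrable_slab: "integrable \<gamma> (indicator (slab \<delta> u) :: _ \<Rightarrow> real)"
  using finite_measure.emeasure_finite [OF finite_measure_grassmann]
  by (intro integrable_real_indicator) (auto simp: less_top)

lemma integral_slab: "(\<integral>V. indicator (slab \<delta> u) V \<partial>\<gamma>) = measure \<gamma> (slab \<delta> u)"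
  by (simp add: measure_def slab_def Int_def conj_commute cong: conj_cong)

lemma measure_slab_le:
  assumes "u \<noteq> 0" "0 \<le> \<delta>"
  shows "measure \<gamma> (slab \<delta> u) \<le> (slab_const CARD('p) k * \<delta>) ^ k"
proof -
  interpret finite_measure \<gamma> by (rule finite_measure_grassmann)
  define d where "d = CARD('p)"
  define a where "a = slab_const CARD('p) k * \<delta>"
  have "0 \<le> a" using assms by (simp add: a_def slab_const_def)
  \<comment> \<open>The summand \<open>1 / real m\<close> comes from the \<open>+ 1\<close> in
    counting the integers of an interval and disappears as \<open>m\<close> grows.\<close>
  have bound: "measure \<gamma> (slab \<delta> u) \<le> (a + 1 / real m) ^ k" if "0 < m" for m :: nat
  proof -
    \<comment> \<open>Coordinates start at 1, so no lattice point is zero and all their slabs have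
      the same measure.\<close>
    define X where "X = (\<Pi>\<^sub>E b\<in>(Basis::(real^'p) set). {1..int m})"
    have "finite X" by (simp add: X_def finite_PiE)
    have "card X = m ^ d" by (simp add: X_def card_PiE d_def)
    have coord: "lattice_point x \<bullet> b = of_int (x b)" if "b \<in> Basis" for x and b :: "real ^ 'p"
      using that by (simp add: lattice_point_def)
    have nz: "lattice_point x \<noteq> 0" if "x \<in> X" for x
    proof
      obtain b :: "real ^ 'p" where b: "b \<in> Basis" using nonempty_Basis by blast
      assume "lattice_point x = 0"
      then have "x b = 0" using coord [OF b, of x] by simp
      moreover have "x b \<in> {1..int m}" using that b unfolding X_def by (rule PiE_mem)
      ultimately show False by simp
    qed
    have norm_le: "norm (lattice_point x) \<le> d * real m" if "x \<in> X" for x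
    proof -
      have "norm (lattice_point x) \<le> (\<Sum>b\<in>Basis. \<bar>lattice_point x \<bullet> b\<bar>)" by (rule norm_le_l1)
      also have "\<dots> \<le> (\<Sum>b\<in>(Basis::(real^'p) set). real m)"
        by (intro sum_mono) (use that in \<open>auto simp: coord X_def PiE_iff\<close>)
      finally show ?thesis by (simp add: d_def)
    qed
    \<comment> \<open>The product of the bounds for \<open>norm (v i)\<close> and for the projection
      of a lattice point whose slab contains \<open>V\<close>.\<close>
    define r where "r = (1 + d) ^ k * (\<delta> * (d * real m))"
    have "0 \<le> r" using assms by (simp add: r_def)
    have count: "real (card {x \<in> X. V \<in> slab \<delta> (lattice_point x)}) \<le> real m ^ (d - k) * (2 * r + 1) ^ k"
      and "k \<le> d" if "V \<in> space \<gamma>" for V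
    proof -
      have V: "subspace V" "dim V = k" using that by (auto simp: space_grassmann grassmannian_def)
      from subspace_pivots [OF V] obtain I v where
        piv: "I \<subseteq> Basis \<and> card I = k \<and> (\<forall>i\<in>I. v i \<in> V \<and> norm (v i) \<le> (1 + DIM(real^'p)) ^ k) \<and>
          (\<forall>i\<in>I. \<forall>j\<in>I. v i \<bullet> j = (if i = j then 1 else 0))"
        by (elim exE)
      then have I: "I \<subseteq> Basis" "card I = k"
        and v: "\<And>i. i \<in> I \<Longrightarrow> v i \<in> V" "\<And>i. i \<in> I \<Longrightarrow> norm (v i) \<le> (1 + d) ^ k"
        and delta: "\<And>i j. i \<in> I \<Longrightarrow> j \<in> I \<Longrightarrow> v i \<bullet> j = (if i = j then 1 else 0)"
        by (auto simp: d_def)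
      show "k \<le> d" using dim_subset_UNIV [of V] V by (simp add: d_def)
      have "{x \<in> X. V \<in> slab \<delta> (lattice_point x)}
          \<subseteq> {x \<in> X. \<forall>i\<in>I. \<bar>lattice_point x \<bullet> v i\<bar> \<le> r}"
      proof clarify
        fix x i assume x: "x \<in> X" "V \<in> slab \<delta> (lattice_point x)" and "i \<in> I"
        have "\<bar>lattice_point x \<bullet> v i\<bar> = \<bar>orth_proj V (lattice_point x) \<bullet> v i\<bar>"
          using V v \<open>i \<in> I\<close> by (simp add: inner_orth_proj)
        also have "\<dots> \<le> norm (orth_proj V (lattice_point x)) * norm (v i)" by (rule Cauchy_Schwarz_ineq2)
        also have "\<dots> \<le> (\<delta> * norm (lattice_point x)) * (1 + d) ^ k"
          using x v(2)[OF \<open>i \<in> I\<close>] assms by (intro mult_mono) (auto simp: slab_def)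
        also have "\<dots> \<le> (\<delta> * (d * real m)) * (1 + d) ^ k"
          using norm_le [OF x(1)] assms by (intro mult_right_mono mult_left_mono) auto
        finally show "\<bar>lattice_point x \<bullet> v i\<bar> \<le> r" by (simp add: r_def mult.commute)
      qed
      then have "card {x \<in> X. V \<in> slab \<delta> (lattice_point x)}
          \<le> card {x \<in> X. \<forall>i\<in>I. \<bar>lattice_point x \<bullet> v i\<bar> \<le> r}"
        using \<open>finite X\<close> by (intro card_mono) auto
      also have "real \<dots> \<le> real m ^ (DIM(real^'p) - card I) * (2 * r + 1) ^ card I"
        unfolding X_def by (rule card_lattice_slab_le [OF I(1) \<open>0 \<le> r\<close> delta])
      finally show "real (card {x \<in> X. V \<in> slab \<delta> (lattice_point x)}) \<le> real m ^ (d - k) * (2 * r + 1) ^ k"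
        by (simp add: I d_def)
    qed
    have "real m ^ d * measure \<gamma> (slab \<delta> u) = (\<Sum>x\<in>X. measure \<gamma> (slab \<delta> (lattice_point x)))"
    proof -
      have "measure \<gamma> (slab \<delta> (lattice_point x)) = measure \<gamma> (slab \<delta> u)" if "x \<in> X" for x
        using emeasure_slab_eq [OF nz [OF that] assms(1), of \<delta>] by (simp add: measure_def)
      then show ?thesis by (simp add: \<open>card X = m ^ d\<close>)
    qed
    also have "\<dots> = (\<integral>V. (\<Sum>x\<in>X. indicator (slab \<delta> (lattice_point x)) V) \<partial>\<gamma>)"
      by (subst Bochner_Integration.integral_sum) (auto simp: integrable_slab integral_slab)
    also have "\<dots> \<le> (\<integral>V. real m ^ (d - k) * (2 * r + 1) ^ k \<partial>\<gamma>)"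
    proof (rule integral_mono)
      fix V assume "V \<in> space \<gamma>"
      have "(\<Sum>x\<in>X. indicator (slab \<delta> (lattice_point x)) V) = real (card {x \<in> X. V \<in> slab \<delta> (lattice_point x)})"
        using \<open>finite X\<close> by (simp add: indicator_def sum.If_cases Int_def)
      then show "(\<Sum>x\<in>X. indicator (slab \<delta> (lattice_point x)) V) \<le> real m ^ (d - k) * (2 * r + 1) ^ k"
        using count [OF \<open>V \<in> space \<gamma>\<close>] by simp
    qed (auto intro!: Bochner_Integration.integrable_sum integrable_slab)
    also have "\<dots> = real m ^ (d - k) * (2 * r + 1) ^ k" by (simp add: measure_space_grassmann)
    also have "2 * r + 1 = real m * (a + 1 / real m)"
      using that by (simp add: r_def a_def slab_const_def d_def field_simps)
    also have "real m ^ (d - k) * (real m * (a + 1 / real m)) ^ k = real m ^ d * (a + 1 / real m) ^ k"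
    proof -
      \<comment> \<open>Total mass 1 provides a subspace of dimension \<open>k\<close>, hence
        \<open>k \<le> d\<close>, and the natural-number difference \<open>d - k\<close> is not
        truncated.\<close>
      obtain V where "V \<in> space \<gamma>" using measure_space_grassmann by (cases "space \<gamma> = {}") auto
      then have "k \<le> d" by (rule \<open>\<And>V. V \<in> space \<gamma> \<Longrightarrow> k \<le> d\<close>)
      then show ?thesis by (simp add: power_mult_distrib power_add [symmetric] mult.assoc [symmetric])
    qed
    finally show ?thesis using that by simp
  qed
  have "(\<lambda>m. (a + 1 / real (Suc m)) ^ k) \<longlonglongrightarrow> (a + 0) ^ k"
    by (intro tendsto_intros LIMSEQ_inverse_real_of_nat [unfolded inverse_eq_divide])
  then have "measure \<gamma> (slab \<delta> u) \<le> (a + 0) ^ k"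
    by (rule LIMSEQ_le_const) (use bound in blast)
  then show ?thesis by (simp add: a_def)
qed

text \<open>After division by \<open>norm u\<close>, layer \<open>p\<close> of the kernel is
  controlled by the slab of width \<open>(1/2) ^ p\<close>, whose measure is of order
  \<open>((1/2) ^ p) ^ k\<close>; the layers sum because \<open>s < k\<close>. The cutoff
  \<open>\<epsilon>\<close> determines the number of layers but does not enter the bound.\<close>

lemma nn_integral_orth_proj_powr_le:
  assumes "u \<noteq> 0" "0 < \<epsilon>" "0 \<le> s" "s < real k"
  shows "(\<integral>\<^sup>+V. ennreal (max (norm (orth_proj V u)) \<epsilon> powr - s) \<partial>\<gamma>)
    \<le> ennreal ((1 + slab_const CARD('p) k ^ k * (2 powr s / (1 - 2 powr (s - k)))) * norm u powr - s)"
proof -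
  interpret finite_measure \<gamma> by (rule finite_measure_grassmann)
  have "0 < norm u" using assms by simp
  obtain K where K: "(1/2) ^ K < \<epsilon> / norm u"
    using real_arch_pow_inv [of "\<epsilon> / norm u" "1/2"] assms by auto
  define h where "h V = 1 + (\<Sum>p\<le>K. 2 powr (s * (real p + 1)) * indicator (slab ((1/2) ^ p) u) V)" for V
  have le: "max (norm (orth_proj V u)) \<epsilon> powr - s \<le> h V * norm u powr - s" if "V \<in> space \<gamma>" for V
  proof -
    define \<rho> where "\<rho> = max (norm (orth_proj V u)) \<epsilon> / norm u"
    have "(1/2) ^ K \<le> \<epsilon> / norm u" using K by simp
    also have "\<dots> \<le> \<rho>" unfolding \<rho>_def by (intro divide_right_mono) auto
    finally have "\<rho> powr - s \<le> 1 + (\<Sum>p\<le>K. 2 powr (s * (real p + 1)) * of_bool (\<rho> \<le> (1/2) ^ p))"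
      using assms by (intro dyadic_powr_bound)
    also have "\<dots> \<le> h V"
      unfolding h_def
    proof (intro add_left_mono sum_mono mult_left_mono)
      fix p
      have "V \<in> slab ((1/2) ^ p) u" if "\<rho> \<le> (1/2) ^ p"
      proof -
        have "max (norm (orth_proj V u)) \<epsilon> \<le> (1/2) ^ p * norm u"
          using that \<open>0 < norm u\<close> unfolding \<rho>_def by (simp add: pos_divide_le_eq)
        then show ?thesis using \<open>V \<in> space \<gamma>\<close> by (simp add: slab_def)
      qed
      then show "of_bool (\<rho> \<le> (1/2) ^ p) \<le> (indicator (slab ((1/2) ^ p) u) V :: real)"
        by (simp add: indicator_def)
    qed auto
    finally have "\<rho> powr - s * norm u powr - s \<le> h V * norm u powr - s"
      by (intro mult_right_mono) auto
    also have "\<rho> powr - s * norm u powr - s = max (norm (orth_proj V u)) \<epsilon> powr - s"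
      using assms by (subst powr_mult [symmetric]) (auto simp: \<rho>_def)
    finally show ?thesis .
  qed
  have h_nonneg: "0 \<le> h V" for V by (auto simp: h_def intro!: add_nonneg_nonneg sum_nonneg)
  have int_h: "integrable \<gamma> h" unfolding h_def
    by (intro Bochner_Integration.integrable_add Bochner_Integration.integrable_sum
        integrable_mult_right integrable_slab integrable_const)
  have "(\<integral>\<^sup>+V. ennreal (max (norm (orth_proj V u)) \<epsilon> powr - s) \<partial>\<gamma>)
      \<le> (\<integral>\<^sup>+V. ennreal (h V * norm u powr - s) \<partial>\<gamma>)"
    by (intro nn_integral_mono ennreal_leI le)
  also have "\<dots> = ennreal (\<integral>V. h V * norm u powr - s \<partial>\<gamma>)"
    using int_h h_nonneg by (intro nn_integral_eq_integral) auto
  also have "(\<integral>V. h V * norm u powr - s \<partial>\<gamma>) = (\<integral>V. h V \<partial>\<gamma>) * norm u powr - s"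
    by simp
  also have "(\<integral>V. h V \<partial>\<gamma>) = 1 + (\<Sum>p\<le>K. 2 powr (s * (real p + 1)) * measure \<gamma> (slab ((1/2) ^ p) u))"
    unfolding h_def
    by (subst Bochner_Integration.integral_add, simp,
        intro Bochner_Integration.integrable_sum integrable_mult_right integrable_slab,
        subst Bochner_Integration.integral_sum, intro integrable_mult_right integrable_slab)
      (simp add: integral_slab measure_space_grassmann)
  also have "\<dots> \<le> 1 + (\<Sum>p\<le>K. slab_const CARD('p) k ^ k * (2 powr (s * (real p + 1)) * ((1/2) ^ p) powr k))"
  proof (intro add_left_mono sum_mono)
    fix p
    have "measure \<gamma> (slab ((1/2) ^ p) u) \<le> (slab_const CARD('p) k * (1/2) ^ p) ^ k"
      using assms by (intro measure_slab_le) auto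
    also have "\<dots> = slab_const CARD('p) k ^ k * ((1/2) ^ p) powr k"
      by (simp add: power_mult_distrib powr_realpow)
    finally show "2 powr (s * (real p + 1)) * measure \<gamma> (slab ((1/2) ^ p) u)
        \<le> slab_const CARD('p) k ^ k * (2 powr (s * (real p + 1)) * ((1/2) ^ p) powr k)"
      by (simp add: mult.left_commute mult_left_mono)
  qed
  also have "\<dots> \<le> 1 + slab_const CARD('p) k ^ k * (2 powr s / (1 - 2 powr (s - k)))"
    unfolding sum_distrib_left [symmetric]
    using dyadic_powr_sum_le [OF assms(4), of K]
    by (intro add_left_mono mult_left_mono) (auto simp: slab_const_nonneg)
  finally show ?thesis by (simp add: mult_right_mono ennreal_leI)
qed

end

section \<open>Energies\<close>

text \<open>Around a fixed \<open>x\<close>, the mass within distance \<open>(1/2) ^ p\<close> sits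
  in at most \<open>3 ^ DIM('a)\<close> cubes, each of mass at most \<open>dyadic_cost t p\<close>.
  The cutoff at \<open>(1/2) ^ N\<close> stops the layers where the mass bound stops, and the
  constant does not involve \<open>N\<close>.\<close>

lemma dyadic_energy_le:
  fixes X :: "'a::euclidean_space set"
  assumes "finite X" and w: "\<And>x. 0 \<le> w x" and "0 \<le> s" "s < t"
    and frostman: "\<And>k i. k \<le> N \<Longrightarrow> (\<Sum>x | x \<in> X \<and> dyadic k x = i. w x) \<le> dyadic_cost t k"
  shows "(\<Sum>x\<in>X. \<Sum>y\<in>X. w x * w y * max (norm (x - y)) ((1/2) ^ N) powr - s)
    \<le> sum w X * (sum w X + 3 ^ DIM('a) * (2 powr s / (1 - 2 powr (s - t))))"
proof -
  let ?\<rho> = "\<lambda>x y. max (norm (x - y)) ((1/2) ^ N)"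
  have "(\<Sum>y\<in>X. w y * ?\<rho> x y powr - s) \<le> sum w X + 3 ^ DIM('a) * (2 powr s / (1 - 2 powr (s - t)))" for x
  proof -
    have near: "(\<Sum>y\<in>X. w y * of_bool (?\<rho> x y \<le> (1/2) ^ p)) \<le> 3 ^ DIM('a) * dyadic_cost t p" if "p \<le> N" for p
    proof -
      define D where "D = dyadic p ` {y. norm (x - y) \<le> (1/2) ^ p}"
      define Y where "Y = {y \<in> X. norm (x - y) \<le> (1/2) ^ p}"
      have "finite Y" using \<open>finite X\<close> by (simp add: Y_def)
      have "(\<Sum>y\<in>X. w y * of_bool (?\<rho> x y \<le> (1/2) ^ p)) \<le> (\<Sum>y\<in>X. if norm (x - y) \<le> (1/2) ^ p then w y else 0)"
        by (intro sum_mono) (auto simp: w)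
      also have "\<dots> = sum w Y" using \<open>finite X\<close> by (simp add: Y_def sum.inter_filter)
      also have "\<dots> = (\<Sum>i\<in>D. \<Sum>y | y \<in> Y \<and> dyadic p y = i. w y)"
        using \<open>finite Y\<close> dyadic_image_near(1) [where x = x and k = p]
        by (intro sum.group [symmetric]) (auto simp: D_def Y_def)
      also have "\<dots> \<le> (\<Sum>i\<in>D. dyadic_cost t p)"
      proof (rule sum_mono)
        fix i
        have "(\<Sum>y | y \<in> Y \<and> dyadic p y = i. w y) \<le> (\<Sum>y | y \<in> X \<and> dyadic p y = i. w y)"
          using \<open>finite X\<close> by (intro sum_mono2) (auto simp: Y_def w)
        also note frostman [OF that]
        finally show "(\<Sum>y | y \<in> Y \<and> dyadic p y = i. w y) \<le> dyadic_cost t p" .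
      qed
      also have "\<dots> = real (card D) * dyadic_cost t p" by simp
      also have "\<dots> \<le> 3 ^ DIM('a) * dyadic_cost t p"
      proof (rule mult_right_mono)
        have "card D \<le> 3 ^ DIM('a)" unfolding D_def by (rule dyadic_image_near(2))
        then have "real (card D) \<le> real (3 ^ DIM('a))" by (simp only: of_nat_le_iff)
        then show "real (card D) \<le> 3 ^ DIM('a)" by simp
      qed simp
      finally show ?thesis .
    qed
    have "(\<Sum>y\<in>X. w y * ?\<rho> x y powr - s)
        \<le> (\<Sum>y\<in>X. w y * (1 + (\<Sum>p\<le>N. 2 powr (s * (real p + 1)) * of_bool (?\<rho> x y \<le> (1/2) ^ p))))"
      using w \<open>0 \<le> s\<close> by (intro sum_mono mult_left_mono dyadic_powr_bound) auto
    also have "\<dots> = sum w X + (\<Sum>y\<in>X. \<Sum>p\<le>N. 2 powr (s * (real p + 1)) * (w y * of_bool (?\<rho> x y \<le> (1/2) ^ p)))"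
      by (simp only: distrib_left sum.distrib mult_1_right sum_distrib_left mult.left_commute)
    also have "\<dots> = sum w X + (\<Sum>p\<le>N. 2 powr (s * (real p + 1)) * (\<Sum>y\<in>X. w y * of_bool (?\<rho> x y \<le> (1/2) ^ p)))"
      by (subst sum.swap) (simp only: sum_distrib_left)
    also have "\<dots> \<le> sum w X + (\<Sum>p\<le>N. 2 powr (s * (real p + 1)) * (3 ^ DIM('a) * dyadic_cost t p))"
      by (intro add_left_mono sum_mono mult_left_mono near) auto
    also have "\<dots> = sum w X + 3 ^ DIM('a) * (\<Sum>p\<le>N. 2 powr (s * (real p + 1)) * dyadic_cost t p)"
      by (simp only: sum_distrib_left mult.left_commute)
    also have "\<dots> \<le> sum w X + 3 ^ DIM('a) * (2 powr s / (1 - 2 powr (s - t)))"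
      using dyadic_powr_sum_le [OF \<open>s < t\<close>, of N] by (intro add_left_mono mult_left_mono) auto
    finally show ?thesis .
  qed
  then have "(\<Sum>x\<in>X. w x * (\<Sum>y\<in>X. w y * ?\<rho> x y powr - s))
      \<le> (\<Sum>x\<in>X. w x * (sum w X + 3 ^ DIM('a) * (2 powr s / (1 - 2 powr (s - t)))))"
    using w by (intro sum_mono mult_left_mono)
  then show ?thesis by (simp only: sum_distrib_left sum_distrib_right mult.assoc)
qed

text \<open>The content of every \<open>A j\<close> exceeds \<open>a = ennreal \<eta>\<close>, so
  the weights found there can be scaled down to the common mass \<open>\<eta>\<close> without losing
  the bounds on cubes. This makes the energy bound \<open>c\<close> the same for all
  \<open>j\<close>.\<close>

lemma analytic_set_frostman:
  fixes B :: "'a::euclidean_space set"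
  assumes "analytic_set B" "hausdorff_measure t B \<noteq> 0" "0 < s" "s < t"
  obtains K X w \<eta> c where "compact K" "K \<subseteq> B" "0 < \<eta>"
    "\<And>j. finite (X j)" "\<And>j x. 0 \<le> w j x" "\<And>j. sum (w j) (X j) = \<eta>"
    "\<And>j. (\<Sum>x\<in>X j. \<Sum>y\<in>X j. w j x * w j y * max (norm (x - y)) ((1/2) ^ j) powr - s) \<le> c"
    "\<And>U. open U \<Longrightarrow> K \<subseteq> U \<Longrightarrow> eventually (\<lambda>j. X j \<subseteq> U) sequentially"
proof -
  have "0 < dyadic_content t B"
    using hausdorff_measure_eq_0_of_dyadic_content [of t B] assms by (auto simp: zero_less_iff_neq_zero)
  then obtain a where a: "0 < a" "a < dyadic_content t B" using dense by blast
  then have "a < top" by (meson le_less_trans less_le_not_le linorder_not_le top_greatest)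
  then obtain \<eta> where \<eta>: "a = ennreal \<eta>" "0 < \<eta>" using a(1) by (cases a) auto
  obtain K A where K: "compact K" "K \<subseteq> B" and A: "\<And>j. a < dyadic_content t (A j)" "\<And>j. bounded (A j)"
    and ev: "\<And>U. open U \<Longrightarrow> K \<subseteq> U \<Longrightarrow> eventually (\<lambda>j. A j \<subseteq> U) sequentially"
    using analytic_set_capacity [OF assms(1) a(2) dyadic.content_incseq] by blast
  define c where "c = \<eta> * (\<eta> + 3 ^ DIM('a) * (2 powr s / (1 - 2 powr (s - t))))"
  define good where "good j X w \<longleftrightarrow> finite X \<and> X \<subseteq> A j \<and> (\<forall>x. 0 \<le> w x) \<and> sum w X = \<eta> \<and>
      (\<Sum>x\<in>X. \<Sum>y\<in>X. w x * w y * max (norm (x - y)) ((1/2) ^ j) powr - s) \<le> c" for j X w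
  have "\<exists>X w. good j X w" for j
  proof -
    obtain X w where X: "finite X" "X \<subseteq> A j" and w: "\<And>x. 0 \<le> w x"
      and le: "dyadic_content t (A j) \<le> ennreal (sum w X)"
      and frostman: "\<And>k i. k \<le> j \<Longrightarrow> (\<Sum>x | x \<in> X \<and> dyadic k x = i. w x) \<le> dyadic_cost t k"
      using dyadic.frostman_weights [where N = j and t = t, OF finite_dyadic_image [OF A(2) [of j]]] by blast
    have "ennreal \<eta> < ennreal (sum w X)" using A(1)[of j] le \<eta> by simp
    then have total: "\<eta> < sum w X" using \<eta> by (simp add: ennreal_less_iff)
    define v where "v x = \<eta> / sum w X * w x" for x
    have factor: "0 \<le> \<eta> / sum w X" "\<eta> / sum w X \<le> 1" using total \<eta> by auto
    have v: "0 \<le> v x" "v x \<le> w x" for x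
      unfolding v_def using factor w by (intro mult_nonneg_nonneg mult_left_le_one_le; blast)+
    have "sum v X = \<eta> / sum w X * sum w X" unfolding v_def by (rule sum_distrib_left [symmetric])
    then have "sum v X = \<eta>" using total \<eta> by simp
    moreover have "(\<Sum>x\<in>X. \<Sum>y\<in>X. v x * v y * max (norm (x - y)) ((1/2) ^ j) powr - s)
      \<le> sum v X * (sum v X + 3 ^ DIM('a) * (2 powr s / (1 - 2 powr (s - t))))"
    proof (rule dyadic_energy_le [OF X(1) v(1)])
      fix k i assume "k \<le> j"
      have "(\<Sum>x | x \<in> X \<and> dyadic k x = i. v x) \<le> (\<Sum>x | x \<in> X \<and> dyadic k x = i. w x)"
        using v by (intro sum_mono)
      also note frostman [OF \<open>k \<le> j\<close>]
      finally show "(\<Sum>x | x \<in> X \<and> dyadic k x = i. v x) \<le> dyadic_cost t k" .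
    qed (use assms in auto)
    ultimately show ?thesis using X v(1) unfolding good_def c_def by (intro exI[of _ X] exI[of _ v]) simp
  qed
  then obtain X w where "\<And>j. good j (X j) (w j)" by metis
  then have Xw: "\<And>j. finite (X j)" "\<And>j. X j \<subseteq> A j" "\<And>j x. 0 \<le> w j x" "\<And>j. sum (w j) (X j) = \<eta>"
    "\<And>j. (\<Sum>x\<in>X j. \<Sum>y\<in>X j. w j x * w j y * max (norm (x - y)) ((1/2) ^ j) powr - s) \<le> c"
    unfolding good_def by simp_all
  have "eventually (\<lambda>j. X j \<subseteq> U) sequentially" if "open U" "K \<subseteq> U" for U
    using ev [OF that] by eventually_elim (use Xw(2) in blast)
  then show thesis by (rule that [OF K \<eta>(2) Xw(1,3-5)])
qed

text \<open>Allows a cover to be thickened to open sets at arbitrarily small cost; at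
  \<open>d = 0\<close> the continuity rests on \<open>0 < s\<close>.\<close>

lemma ex_larger_powr_le:
  fixes d s \<zeta> :: real
  assumes "0 \<le> d" "0 < s" "0 < \<zeta>"
  shows "\<exists>r>0. (d + 2 * r) powr s \<le> d powr s + \<zeta>"
proof -
  have pos: "eventually (\<lambda>r::real. 0 < r) (at_right 0)" by (rule eventually_at_right_less)
  then have "eventually (\<lambda>r. 0 \<le> d + 2 * r) (at_right 0)"
    by eventually_elim (use assms in simp)
  then have "((\<lambda>r. (d + 2 * r) powr s) \<longlongrightarrow> (d + 2 * 0) powr s) (at_right 0)"
    using assms by (intro tendsto_powr' tendsto_intros) auto
  then have "eventually (\<lambda>r. (d + 2 * r) powr s < d powr s + \<zeta>) (at_right 0)"
    using assms by (intro order_tendstoD) auto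
  with pos have "eventually (\<lambda>r. 0 < r \<and> (d + 2 * r) powr s \<le> d powr s + \<zeta>) (at_right 0)"
    by eventually_elim simp
  from eventually_happens' [OF _ this] show ?thesis by simp
qed

text \<open>\<open>h\<close> assigns each point to one covering set, so the blocks
  \<open>h x = h y\<close> of the double sum are disjoint and bound the sum of
  \<open>(W i)\<^sup>2 * e i powr - s\<close> by the energy. Cauchy-Schwarz with the factors
  \<open>e i powr (- s / 2)\<close> and \<open>e i powr (s / 2)\<close> recovers the total
  mass.\<close>

lemma energy_covering_bound:
  fixes \<rho> :: "'a \<Rightarrow> 'a \<Rightarrow> real"
  assumes "finite X" "finite I" and h: "\<And>x. x \<in> X \<Longrightarrow> h x \<in> I"
    and w: "\<And>x. 0 \<le> w x" and e: "\<And>i. i \<in> I \<Longrightarrow> 0 < e i" and \<rho>: "\<And>x y. 0 < \<rho> x y"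
    and \<rho>_le: "\<And>x y. x \<in> X \<Longrightarrow> y \<in> X \<Longrightarrow> h x = h y \<Longrightarrow> \<rho> x y \<le> e (h x)" and "0 \<le> s"
  shows "(sum w X)\<^sup>2 \<le> (\<Sum>x\<in>X. \<Sum>y\<in>X. w x * w y * \<rho> x y powr - s) * (\<Sum>i\<in>I. e i powr s)"
proof -
  define W where "W i = (\<Sum>x | x \<in> X \<and> h x = i. w x)" for i
  have "(\<Sum>i\<in>I. (W i * e i powr (- s / 2))\<^sup>2) \<le> (\<Sum>x\<in>X. \<Sum>y\<in>X. w x * w y * \<rho> x y powr - s)"
  proof -
    have "(W i * e i powr (- s / 2))\<^sup>2 \<le> (\<Sum>x | x \<in> X \<and> h x = i. \<Sum>y\<in>X. w x * w y * \<rho> x y powr - s)"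
      if "i \<in> I" for i
    proof -
      have "(W i * e i powr (- s / 2))\<^sup>2 = W i * W i * e i powr - s"
        by (simp add: power2_eq_square powr_add [symmetric] mult.assoc mult.left_commute)
      also have "\<dots> = (\<Sum>x | x \<in> X \<and> h x = i. \<Sum>y | y \<in> X \<and> h y = i. w x * w y * e i powr - s)"
        unfolding W_def sum_product by (simp only: sum_distrib_right)
      also have "\<dots> \<le> (\<Sum>x | x \<in> X \<and> h x = i. \<Sum>y | y \<in> X \<and> h y = i. w x * w y * \<rho> x y powr - s)"
        using w \<rho> \<open>0 \<le> s\<close>
        by (intro sum_mono mult_left_mono powr_mono2') (auto intro!: order_trans [OF \<rho>_le])
      also have "\<dots> \<le> (\<Sum>x | x \<in> X \<and> h x = i. \<Sum>y\<in>X. w x * w y * \<rho> x y powr - s)"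
        using \<open>finite X\<close> w by (intro sum_mono sum_mono2) auto
      finally show ?thesis .
    qed
    then have "(\<Sum>i\<in>I. (W i * e i powr (- s / 2))\<^sup>2)
        \<le> (\<Sum>i\<in>I. \<Sum>x | x \<in> X \<and> h x = i. \<Sum>y\<in>X. w x * w y * \<rho> x y powr - s)"
      by (rule sum_mono)
    also have "\<dots> = (\<Sum>x\<in>X. \<Sum>y\<in>X. w x * w y * \<rho> x y powr - s)"
      using assms(1,2) h by (intro sum.group) auto
    finally show ?thesis .
  qed
  moreover have "(\<Sum>i\<in>I. (e i powr (s / 2))\<^sup>2) = (\<Sum>i\<in>I. e i powr s)"
    by (simp add: power2_eq_square powr_add [symmetric])
  moreover have "sum w X = (\<Sum>i\<in>I. (W i * e i powr (- s / 2)) * e i powr (s / 2))"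
  proof -
    have "sum w X = (\<Sum>i\<in>I. W i)"
      unfolding W_def using assms(1,2) h by (intro sum.group [symmetric]) auto
    also have "\<dots> = (\<Sum>i\<in>I. (W i * e i powr (- s / 2)) * e i powr (s / 2))"
      using e by (intro sum.cong) (auto simp: mult.assoc powr_add [symmetric] less_imp_neq [symmetric])
    finally show ?thesis .
  qed
  ultimately show ?thesis
    using Cauchy_Schwarz_ineq_sum [of "\<lambda>i. W i * e i powr (- s / 2)" "\<lambda>i. e i powr (s / 2)" I]
    by (smt (verit) mult_right_mono sum_nonneg powr_ge_zero)
qed

text \<open>For covers of the image of \<open>K\<close> by sets of diameter at most 1, the sum is
  bounded below by \<open>\<eta>\<^sup>2 / L\<close> up to an arbitrarily small error. With such
  diameters the exponent may be lowered from \<open>s\<close> to any \<open>s'\<close>, including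
  0.\<close>

lemma hausdorff_measure_image_nonzero:
  fixes f :: "'a::topological_space \<Rightarrow> 'b::metric_space"
  assumes f: "continuous_on UNIV f" and "compact K" and s: "0 < s" "0 \<le> s'" "s' \<le> s" and "0 < \<eta>"
    and X: "\<And>j. finite (X j)" and w: "\<And>j x. 0 \<le> w j x" and total: "\<And>j. sum (w j) (X j) = \<eta>"
    and ev: "\<And>U. open U \<Longrightarrow> K \<subseteq> U \<Longrightarrow> eventually (\<lambda>j. X j \<subseteq> U) sequentially"
    and energy: "frequently (\<lambda>j. (\<Sum>x\<in>X j. \<Sum>y\<in>X j.
        w j x * w j y * max (dist (f x) (f y)) ((1/2) ^ j) powr - s) \<le> L) sequentially"
  shows "hausdorff_measure s' (f ` K) \<noteq> 0"
proof -
  have bound: "ennreal (\<eta>\<^sup>2) \<le> ennreal L * (\<Sum>i. diam_pow s' (U i)) + ennreal (L * \<zeta>) \<and> 0 < L"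
    if cov: "f ` K \<subseteq> (\<Union>i. U i)" and U: "\<And>i. bounded (U i) \<and> diameter (U i) \<le> 1" and "0 < \<zeta>"
    for U :: "nat \<Rightarrow> 'b set" and \<zeta> :: real
  proof -
    have "\<exists>r>0. (diameter (U i) + 2 * r) powr s \<le> diameter (U i) powr s + \<zeta> * (1/2) ^ Suc i" for i
      using U \<open>0 < \<zeta>\<close> s by (intro ex_larger_powr_le diameter_ge_0) auto
    then obtain r where r: "\<And>i. 0 < r i"
      "\<And>i. (diameter (U i) + 2 * r i) powr s \<le> diameter (U i) powr s + \<zeta> * (1/2) ^ Suc i" by metis
    define e where "e i = diameter (U i) + 2 * r i" for i
    have e_pos: "0 < e i" for i using r(1)[of i] diameter_ge_0 [of "U i"] U by (simp add: e_def add_nonneg_pos)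
    \<comment> \<open>Thickening makes the preimages open, so that finitely many of them cover
      \<open>K\<close> and, eventually, all of \<open>X j\<close>; the radii add at most
      \<open>\<zeta>\<close> to the sum of powers.\<close>
    define G where "G i = (\<Union>x\<in>U i. ball x (r i))" for i
    have "open (G i)" for i unfolding G_def by auto
    have G_dist: "dist y z \<le> e i" if yz: "y \<in> G i" "z \<in> G i" for y z i
    proof -
      obtain p q where pq: "p \<in> U i" "dist p y < r i" "q \<in> U i" "dist q z < r i"
        using yz by (auto simp: G_def)
      have "dist p q \<le> diameter (U i)" using U pq by (intro diameter_bounded_bound) auto
      moreover have "dist y z \<le> dist p y + dist p q + dist q z"
        using dist_triangle [of y z p] dist_triangle [of p z q] by (simp add: dist_commute)
      ultimately show ?thesis using pq by (simp add: e_def)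
    qed
    have K_cov: "K \<subseteq> (\<Union>i. f -` G i)"
    proof
      fix x assume "x \<in> K"
      then obtain i where "f x \<in> U i" using cov by auto
      then have "f x \<in> G i" using r(1)[of i] by (auto simp: G_def intro!: bexI[of _ "f x"])
      then show "x \<in> (\<Union>i. f -` G i)" by auto
    qed
    have op: "open (f -` G i)" for i by (rule open_vimage [OF \<open>open (G i)\<close> f])
    obtain J where J: "finite J" "K \<subseteq> (\<Union>i\<in>J. f -` G i)"
      by (rule compactE_image [OF \<open>compact K\<close> op K_cov])
    define I where "I = {i \<in> J. U i \<noteq> {}}"
    have "finite I" using J(1) by (simp add: I_def)
    have cover_I: "(\<Union>i\<in>J. f -` G i) = (\<Union>i\<in>I. f -` G i)" by (auto simp: I_def G_def)
    have "eventually (\<lambda>j. X j \<subseteq> (\<Union>i\<in>I. f -` G i)) sequentially"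
      using J(2) op unfolding cover_I by (intro ev open_UN) auto
    \<comment> \<open>For such \<open>j\<close> the cutoff stays below every \<open>e i\<close>, so
      the truncated distance within a covering set is still at most \<open>e i\<close>.\<close>
    moreover have "eventually (\<lambda>j. \<forall>i\<in>I. (1/2) ^ j \<le> e i) sequentially"
    proof (intro eventually_ball_finite [OF \<open>finite I\<close>] ballI)
      fix i
      have "(\<lambda>j. (1/2::real) ^ j) \<longlonglongrightarrow> 0" by (rule LIMSEQ_power_zero) simp
      from order_tendstoD(2) [OF this e_pos [of i]]
      show "eventually (\<lambda>j. (1/2) ^ j \<le> e i) sequentially" by eventually_elim simp
    qed
    ultimately have "eventually (\<lambda>j. X j \<subseteq> (\<Union>i\<in>I. f -` G i) \<and> (\<forall>i\<in>I. (1/2) ^ j \<le> e i)) sequentially"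
      by eventually_elim simp
    \<comment> \<open>The energy bound holds for infinitely many \<open>j\<close> and the other two
      conditions for all large \<open>j\<close>, so some \<open>j\<close> satisfies all
      three.\<close>
    from frequently_ex [OF frequently_eventually_frequently [OF energy this]]
    obtain j where j: "(\<Sum>x\<in>X j. \<Sum>y\<in>X j. w j x * w j y * max (dist (f x) (f y)) ((1/2) ^ j) powr - s) \<le> L"
      "X j \<subseteq> (\<Union>i\<in>I. f -` G i)" "\<forall>i\<in>I. (1/2) ^ j \<le> e i" by blast
    have "\<forall>x\<in>X j. \<exists>i\<in>I. f x \<in> G i" using j(2) by auto
    then obtain h where h: "\<And>x. x \<in> X j \<Longrightarrow> h x \<in> I \<and> f x \<in> G (h x)" by metis
    have "(sum (w j) (X j))\<^sup>2 \<le> (\<Sum>x\<in>X j. \<Sum>y\<in>X j. w j x * w j y *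
        max (dist (f x) (f y)) ((1/2) ^ j) powr - s) * (\<Sum>i\<in>I. e i powr s)"
    proof (rule energy_covering_bound [OF X \<open>finite I\<close>, where h = h])
      fix x y assume xy: "x \<in> X j" "y \<in> X j" "h x = h y"
      then have "dist (f x) (f y) \<le> e (h x)" using h [of x] h [of y] by (intro G_dist) auto
      then show "max (dist (f x) (f y)) ((1/2) ^ j) \<le> e (h x)" using j(3) h [of x] xy by auto
    qed (use h w e_pos s in \<open>auto simp: less_max_iff_disj\<close>)
    also have "\<dots> \<le> L * (\<Sum>i\<in>I. e i powr s)"
      using j(1) by (intro mult_right_mono sum_nonneg) auto
    finally have main: "\<eta>\<^sup>2 \<le> L * (\<Sum>i\<in>I. e i powr s)" by (simp add: total)
    have "0 < L"
    proof (rule ccontr)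
      assume "\<not> 0 < L"
      then have "L * (\<Sum>i\<in>I. e i powr s) \<le> 0" by (intro mult_nonpos_nonneg sum_nonneg) auto
      moreover have "0 < \<eta>\<^sup>2" using \<open>0 < \<eta>\<close> by simp
      ultimately show False using main by linarith
    qed
    have piece: "ennreal (e i powr s) \<le> diam_pow s' (U i) + ennreal (\<zeta> * (1/2) ^ Suc i)" if "i \<in> I" for i
    proof -
      have d: "0 \<le> diameter (U i)" "diameter (U i) \<le> 1" using U diameter_ge_0 by auto
      \<comment> \<open>Diameters are at most 1, so lowering the exponent does not decrease the
        power; at \<open>s' = 0\<close> a nonempty set contributes 1.\<close>
      have "ennreal (diameter (U i) powr s) \<le> diam_pow s' (U i)"
        using that d s powr_le1 [of s "diameter (U i)"]
        by (auto simp: I_def diam_pow_def intro!: ennreal_leI powr_mono')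
      moreover have "ennreal (e i powr s) \<le> ennreal (diameter (U i) powr s + \<zeta> * (1/2) ^ Suc i)"
        using r(2)[of i] unfolding e_def by (rule ennreal_leI)
      moreover have "\<dots> = ennreal (diameter (U i) powr s) + ennreal (\<zeta> * (1/2) ^ Suc i)"
        using \<open>0 < \<zeta>\<close> by (intro ennreal_plus) auto
      ultimately show ?thesis using add_right_mono order_trans by metis
    qed
    have "ennreal (\<Sum>i\<in>I. e i powr s) = (\<Sum>i\<in>I. ennreal (e i powr s))" by (simp add: sum_ennreal)
    also have "\<dots> \<le> (\<Sum>i\<in>I. diam_pow s' (U i) + ennreal (\<zeta> * (1/2) ^ Suc i))"
      by (intro sum_mono piece)
    also have "\<dots> = (\<Sum>i\<in>I. diam_pow s' (U i)) + ennreal (\<Sum>i\<in>I. \<zeta> * (1/2) ^ Suc i)"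
      using \<open>0 < \<zeta>\<close> by (subst sum_ennreal [symmetric]) (auto simp: sum.distrib)
    also have "\<dots> \<le> (\<Sum>i. diam_pow s' (U i)) + ennreal \<zeta>"
    proof (intro add_mono ennreal_leI)
      show "(\<Sum>i\<in>I. diam_pow s' (U i)) \<le> (\<Sum>i. diam_pow s' (U i))"
        using \<open>finite I\<close> by (intro sum_le_suminf) auto
      have "(\<Sum>i\<in>I. (1/2::real) ^ Suc i) \<le> (\<Sum>i. (1/2) ^ Suc i)"
        using \<open>finite I\<close> power_half_series by (intro sum_le_suminf) (auto simp: sums_iff)
      also have "\<dots> = 1" using power_half_series by (simp add: sums_iff)
      finally show "(\<Sum>i\<in>I. \<zeta> * (1/2) ^ Suc i) \<le> \<zeta>"
        unfolding sum_distrib_left [symmetric] using \<open>0 < \<zeta>\<close> by (intro mult_left_le) auto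
    qed
    finally have "ennreal L * ennreal (\<Sum>i\<in>I. e i powr s) \<le> ennreal L * ((\<Sum>i. diam_pow s' (U i)) + ennreal \<zeta>)"
      by (intro mult_left_mono) auto
    moreover have "ennreal (\<eta>\<^sup>2) \<le> ennreal L * ennreal (\<Sum>i\<in>I. e i powr s)"
      using main \<open>0 < L\<close> by (subst ennreal_mult [symmetric]) (auto intro: ennreal_leI sum_nonneg)
    ultimately show ?thesis
      using \<open>0 < L\<close> \<open>0 < \<zeta>\<close> by (simp add: distrib_left ennreal_mult)
  qed
  show ?thesis
  proof
    assume "hausdorff_measure s' (f ` K) = 0"
    then have zero: "hausdorff_pre s' 1 (f ` K) = 0"
      by (simp add: hausdorff_measure_def SUP_eq_iff bot_ennreal [symmetric])
    \<comment> \<open>Both terms on the right of \<open>bound\<close> are then at most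
      \<open>L * \<theta>\<close>, and together they stay below \<open>\<eta>\<^sup>2\<close>. The
      modulus is there because \<open>0 < L\<close> is known only after \<open>bound\<close> has
      been applied to a cover.\<close>
    define \<theta> where "\<theta> = \<eta>\<^sup>2 / (4 * (\<bar>L\<bar> + 1))"
    have "0 < \<theta>" using \<open>0 < \<eta>\<close> by (simp add: \<theta>_def add_nonneg_pos)
    then have "hausdorff_pre s' 1 (f ` K) < ennreal \<theta>" by (simp add: zero)
    then obtain U :: "nat \<Rightarrow> 'b set" where U: "f ` K \<subseteq> (\<Union>i. U i)" "\<And>i. bounded (U i) \<and> diameter (U i) \<le> 1"
      "(\<Sum>i. diam_pow s' (U i)) < ennreal \<theta>"
      unfolding hausdorff_pre_def INF_less_iff by blast
    have L: "0 < L" and "ennreal (\<eta>\<^sup>2) \<le> ennreal L * (\<Sum>i. diam_pow s' (U i)) + ennreal (L * \<theta>)"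
      using bound [OF U(1,2) \<open>0 < \<theta>\<close>] by auto
    note this(2)
    also have "ennreal L * (\<Sum>i. diam_pow s' (U i)) + ennreal (L * \<theta>) \<le> ennreal L * ennreal \<theta> + ennreal (L * \<theta>)"
      using U(3) by (intro add_right_mono mult_left_mono) auto
    also have "\<dots> = ennreal (2 * (L * \<theta>))"
      using L \<open>0 < \<theta>\<close> by (simp add: ennreal_mult [symmetric] ennreal_plus [symmetric] del: ennreal_plus)
    finally have "\<eta>\<^sup>2 \<le> 2 * (L * \<theta>)" using L \<open>0 < \<theta>\<close> by (subst (asm) ennreal_le_iff) auto
    also have "\<dots> < \<eta>\<^sup>2" using L \<open>0 < \<eta>\<close> by (simp add: \<theta>_def field_simps add_pos_pos)
    finally show False by simp
  qed
qed

section \<open>Dimension of projections\<close>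

lemma hausdorff_measure_mono:
  assumes "A \<subseteq> B" shows "hausdorff_measure s A \<le> hausdorff_measure s B"
  unfolding hausdorff_measure_def hausdorff_pre_def
  using assms by (intro SUP_mono bexI INF_superset_mono) auto

lemma hausdorff_measure_contraction_le:
  fixes f :: "'a::metric_space \<Rightarrow> 'b::real_normed_vector"
  assumes f: "\<And>x y. dist (f x) (f y) \<le> dist x y" and "0 \<le> s"
  shows "hausdorff_measure s (f ` A) \<le> hausdorff_measure s A"
  unfolding hausdorff_measure_def
proof (intro SUP_mono bexI)
  fix \<delta> :: real assume "\<delta> \<in> {0<..}"
  show "hausdorff_pre s \<delta> (f ` A) \<le> hausdorff_pre s \<delta> A"
    unfolding hausdorff_pre_def [of s \<delta> A]
  proof (rule INF_greatest)
    fix U :: "nat \<Rightarrow> 'a set"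
    assume "U \<in> {U. A \<subseteq> (\<Union>i. U i) \<and> (\<forall>i. bounded (U i) \<and> diameter (U i) \<le> \<delta>)}"
    then have cov: "A \<subseteq> (\<Union>i. U i)" and bdd: "\<And>i. bounded (U i)" and diam: "\<And>i. diameter (U i) \<le> \<delta>"
      by auto
    have diam_f: "diameter (f ` U i) \<le> diameter (U i)" for i
    proof (rule diameter_le)
      show "f ` U i \<noteq> {} \<or> 0 \<le> diameter (U i)" using diameter_ge_0 [OF bdd] by simp
      fix y z assume "y \<in> f ` U i" "z \<in> f ` U i"
      then obtain a b where "a \<in> U i" "b \<in> U i" "y = f a" "z = f b" by auto
      then show "norm (y - z) \<le> diameter (U i)"
        using f [of a b] diameter_bounded_bound [OF bdd, of a i b] by (simp add: dist_norm)
    qed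
    have bdd_f: "bounded (f ` U i)" for i
    proof -
      obtain x e where "\<And>y. y \<in> U i \<Longrightarrow> dist x y \<le> e" using bdd [of i] by (auto simp: bounded_def)
      then show ?thesis
        unfolding bounded_def by (intro exI[of _ "f x"] exI[of _ e]) (use f order_trans in blast)
    qed
    have "hausdorff_pre s \<delta> (f ` A) \<le> (\<Sum>i. diam_pow s (f ` U i))"
      unfolding hausdorff_pre_def
    proof (rule INF_lower, intro CollectI conjI allI)
      show "f ` A \<subseteq> (\<Union>i. f ` U i)" using cov by blast
      show "diameter (f ` U i) \<le> \<delta>" for i using diam_f diam by (rule order_trans)
    qed (rule bdd_f)
    also have "\<dots> \<le> (\<Sum>i. diam_pow s (U i))"
    proof (rule suminf_le)
      fix i
      show "diam_pow s (f ` U i) \<le> diam_pow s (U i)"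
        using diam_f [of i] diameter_ge_0 [OF bdd_f [of i]] \<open>0 \<le> s\<close>
        by (auto simp: diam_pow_def intro!: ennreal_leI powr_mono2)
    qed auto
    finally show "hausdorff_pre s \<delta> (f ` A) \<le> (\<Sum>i. diam_pow s (U i))" .
  qed
qed

lemma hausdorff_dim_contraction_le:
  fixes f :: "'a::metric_space \<Rightarrow> 'b::real_normed_vector"
  assumes "\<And>x y. dist (f x) (f y) \<le> dist x y"
  shows "hausdorff_dim (f ` A) \<le> hausdorff_dim A"
  unfolding hausdorff_dim_def
proof (rule INF_superset_mono)
  show "{s. 0 \<le> s \<and> hausdorff_measure s A = 0} \<subseteq> {s. 0 \<le> s \<and> hausdorff_measure s (f ` A) = 0}"
    using hausdorff_measure_contraction_le [OF assms] by (metis (mono_tags, lifting) Collect_mono le_zero_eq)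
qed simp

lemma hausdorff_measure_nonzero_of_less_dim:
  assumes "0 \<le> s" "ennreal s < hausdorff_dim A" shows "hausdorff_measure s A \<noteq> 0"
  using assms unfolding hausdorff_dim_def by (metis (mono_tags, lifting) INF_lower mem_Collect_eq not_le)

text \<open>The dimension is an infimum over null exponents, so every exponent up to
  \<open>s\<close> has to be excluded; the lower bounds are therefore proved for the whole range of
  \<open>s'\<close>.\<close>

lemma le_hausdorff_dim:
  assumes "\<And>s'. 0 \<le> s' \<Longrightarrow> s' \<le> s \<Longrightarrow> hausdorff_measure s' A \<noteq> 0"
  shows "ennreal s \<le> hausdorff_dim A"
  unfolding hausdorff_dim_def by (intro INF_greatest ennreal_leI) (use assms in force)

lemma orth_proj_Times_UNIV:
  assumes "subspace V"
  shows "orth_proj (V \<times> UNIV) (u, v) = (orth_proj V u, v)"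
proof (rule orth_proj_eqI)
  show "subspace (V \<times> UNIV)" using assms by (intro subspace_Times) auto
qed (use assms in \<open>auto simp: orth_proj_mem orth_proj_inner inner_prod_def\<close>)

text \<open>When \<open>norm z\<close> is below the cutoff or \<open>v\<close> carries half of it,
  the bound holds for each \<open>V\<close> separately; only when \<open>u\<close> carries half is
  the average over \<open>V\<close> used. The factor \<open>2 powr s\<close> in \<open>C\<close>
  pays for the halving.\<close>

lemma nn_integral_orth_proj_Times_powr_le:
  fixes \<gamma> :: "(real ^ 'p) set measure" and z :: "(real ^ 'p) \<times> 'b::euclidean_space"
  assumes \<gamma>: "invariant_grassmann_measure k \<gamma>" and "0 < \<epsilon>" "0 \<le> s" "s < real k"
  defines "C \<equiv> 2 powr s * (1 + slab_const CARD('p) k ^ k * (2 powr s / (1 - 2 powr (s - k))))"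
  shows "(\<integral>\<^sup>+V. ennreal (max (norm (orth_proj (V \<times> UNIV) z)) \<epsilon> powr - s) \<partial>\<gamma>)
    \<le> ennreal (C * max (norm z) \<epsilon> powr - s)"
proof -
  obtain u v where z: "z = (u, v)" by (cases z)
  have sub: "subspace V" if "V \<in> space \<gamma>" for V
    using that by (auto simp: space_grassmann [OF \<gamma>] grassmannian_def)
  have proj: "orth_proj (V \<times> UNIV) z = (orth_proj V u, v)" if "V \<in> space \<gamma>" for V
    unfolding z by (rule orth_proj_Times_UNIV [OF sub [OF that]])
  have total: "emeasure \<gamma> (space \<gamma>) = 1" using \<gamma> unfolding invariant_grassmann_measure_def by blast
  define C' where "C' = 1 + slab_const CARD('p) k ^ k * (2 powr s / (1 - 2 powr (s - k)))"
  have C: "C = 2 powr s * C'" by (simp add: C_def C'_def)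
  have "2 powr (s - k) < 1" using assms(4) by (simp add: powr_less_one)
  then have "1 \<le> C'" by (auto simp: C'_def slab_const_nonneg intro!: mult_nonneg_nonneg divide_nonneg_nonneg zero_le_power)
  moreover have "1 \<le> 2 powr s" using \<open>0 \<le> s\<close> by (simp add: ge_one_powr_ge_zero)
  ultimately have "2 powr s \<le> C" "1 \<le> C" unfolding C by (auto intro: order_trans mult_ge1_I)
  have bounded_case: "?thesis" if "\<And>V. V \<in> space \<gamma> \<Longrightarrow>
      max (norm (orth_proj (V \<times> UNIV) z)) \<epsilon> powr - s \<le> C * max (norm z) \<epsilon> powr - s"
  proof -
    have "(\<integral>\<^sup>+V. ennreal (max (norm (orth_proj (V \<times> UNIV) z)) \<epsilon> powr - s) \<partial>\<gamma>)
        \<le> (\<integral>\<^sup>+V. ennreal (C * max (norm z) \<epsilon> powr - s) \<partial>\<gamma>)"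
      by (intro nn_integral_mono ennreal_leI that)
    then show ?thesis by (simp add: total)
  qed
  have half: "(norm z / 2) powr - s = 2 powr s * norm z powr - s"
    by (simp add: powr_divide powr_minus_divide powr_minus)
  consider "norm z \<le> \<epsilon>" | "\<epsilon> < norm z" "norm z / 2 \<le> norm v" | "\<epsilon> < norm z" "norm z / 2 < norm u"
    using norm_Pair_le [of u v] unfolding z by linarith
  then show ?thesis
  proof cases
    case 1
    show ?thesis
    proof (rule bounded_case)
      fix V
      have "max (norm (orth_proj (V \<times> UNIV) z)) \<epsilon> powr - s \<le> \<epsilon> powr - s"
        using \<open>0 < \<epsilon>\<close> \<open>0 \<le> s\<close> by (intro powr_mono2') auto
      also have "\<dots> = 1 * max (norm z) \<epsilon> powr - s" using 1 by (simp add: max_def)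
      also have "\<dots> \<le> C * max (norm z) \<epsilon> powr - s" using \<open>1 \<le> C\<close> by (intro mult_right_mono) auto
      finally show "max (norm (orth_proj (V \<times> UNIV) z)) \<epsilon> powr - s \<le> C * max (norm z) \<epsilon> powr - s" .
    qed
  next
    case 2
    show ?thesis
    proof (rule bounded_case)
      fix V assume "V \<in> space \<gamma>"
      have "norm z / 2 \<le> norm (orth_proj (V \<times> UNIV) z)"
        using 2(2) norm_snd_le [where x = "orth_proj V u" and y = v] by (simp add: proj [OF \<open>V \<in> space \<gamma>\<close>])
      then have "max (norm (orth_proj (V \<times> UNIV) z)) \<epsilon> powr - s \<le> (norm z / 2) powr - s"
        using 2 \<open>0 < \<epsilon>\<close> \<open>0 \<le> s\<close> by (intro powr_mono2') auto
      also have "\<dots> \<le> C * norm z powr - s"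
        unfolding half using \<open>2 powr s \<le> C\<close> by (intro mult_right_mono) auto
      finally show "max (norm (orth_proj (V \<times> UNIV) z)) \<epsilon> powr - s \<le> C * max (norm z) \<epsilon> powr - s"
        using 2 by (simp add: max_def)
    qed
  next
    case 3
    then have "u \<noteq> 0" using \<open>0 < \<epsilon>\<close> by auto
    have "(\<integral>\<^sup>+V. ennreal (max (norm (orth_proj (V \<times> UNIV) z)) \<epsilon> powr - s) \<partial>\<gamma>)
        \<le> (\<integral>\<^sup>+V. ennreal (max (norm (orth_proj V u)) \<epsilon> powr - s) \<partial>\<gamma>)"
    proof (rule nn_integral_mono)
      fix V assume V: "V \<in> space \<gamma>"
      have "norm (orth_proj V u) \<le> norm (orth_proj (V \<times> UNIV) z)"
        using norm_fst_le [where x = "orth_proj V u" and y = v] by (simp add: proj [OF V])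
      then show "ennreal (max (norm (orth_proj (V \<times> UNIV) z)) \<epsilon> powr - s)
          \<le> ennreal (max (norm (orth_proj V u)) \<epsilon> powr - s)"
        using \<open>0 < \<epsilon>\<close> \<open>0 \<le> s\<close> by (intro ennreal_leI powr_mono2') auto
    qed
    also have "\<dots> \<le> ennreal (C' * norm u powr - s)"
      unfolding C'_def by (rule nn_integral_orth_proj_powr_le [OF \<gamma> \<open>u \<noteq> 0\<close> assms(2-4)])
    also have "\<dots> \<le> ennreal (C' * (norm z / 2) powr - s)"
      using 3 \<open>1 \<le> C'\<close> \<open>0 < \<epsilon>\<close> \<open>0 \<le> s\<close> by (intro ennreal_leI mult_left_mono powr_mono2') auto
    also have "C' * (norm z / 2) powr - s = C * max (norm z) \<epsilon> powr - s"
      unfolding half C using 3 by (simp add: max_def)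
    finally show ?thesis .
  qed
qed

text \<open>The integrals of the projected energies are bounded by \<open>C * c\<close> for all
  \<open>j\<close>, so their lower limit is finite almost everywhere. The indices with bounded
  energy depend on \<open>V\<close>, which is why \<open>hausdorff_measure_image_nonzero\<close>
  asks for a bound only \<open>frequently\<close>.\<close>

lemma AE_le_hausdorff_dim_projection:
  fixes \<gamma> :: "(real ^ 'p) set measure" and B :: "((real ^ 'p) \<times> 'b::euclidean_space) set"
  assumes \<gamma>: "invariant_grassmann_measure k \<gamma>" and B: "analytic_set B" "hausdorff_measure t B \<noteq> 0"
    and s: "0 < s" "s < t" "s < real k"
  shows "AE V in \<gamma>. ennreal s \<le> hausdorff_dim (orth_proj (V \<times> UNIV) ` B)"
proof -
  obtain K X w \<eta> c where K: "compact K" "K \<subseteq> B" "0 < \<eta>"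
    and X: "\<And>j. finite (X j)" and w: "\<And>j x. 0 \<le> w j x" and total: "\<And>j. sum (w j) (X j) = \<eta>"
    and energy: "\<And>j. (\<Sum>x\<in>X j. \<Sum>y\<in>X j. w j x * w j y * max (norm (x - y)) ((1/2) ^ j) powr - s) \<le> c"
    and ev: "\<And>U. open U \<Longrightarrow> K \<subseteq> U \<Longrightarrow> eventually (\<lambda>j. X j \<subseteq> U) sequentially"
    by (rule analytic_set_frostman [OF B s(1,2)]) blast
  define C where "C = 2 powr s * (1 + slab_const CARD('p) k ^ k * (2 powr s / (1 - 2 powr (s - k))))"
  define E where "E j V = (\<Sum>x\<in>X j. \<Sum>y\<in>X j. w j x * w j y *
      max (norm (orth_proj (V \<times> UNIV) (x - y))) ((1/2) ^ j) powr - s)" for j V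
  have sub: "subspace V" if "V \<in> space \<gamma>" for V
    using that by (auto simp: space_grassmann [OF \<gamma>] grassmannian_def)
  have [measurable]: "(\<lambda>V. norm (orth_proj (V \<times> UNIV) z)) \<in> borel_measurable \<gamma>" for z :: "(real^'p) \<times> 'b"
  proof -
    have "(\<lambda>V. norm (orth_proj V (fst z), snd z)) \<in> borel_measurable \<gamma>"
      unfolding norm_Pair using borel_measurable_orth_proj [OF \<gamma>] by simp
    then show ?thesis
      by (rule measurable_cong [THEN iffD1, rotated]) (simp add: orth_proj_Times_UNIV [OF sub, symmetric])
  qed
  have E_le: "(\<integral>\<^sup>+V. ennreal (E j V) \<partial>\<gamma>) \<le> ennreal (C * c)" for j
  proof -
    have "0 \<le> C" by (rule order_trans [of _ "2 powr s"])
      (use s in \<open>auto simp: C_def slab_const_nonneg powr_less_one less_imp_le intro!: mult_nonneg_nonneg divide_nonneg_nonneg zero_le_power\<close>)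
    have "(\<integral>\<^sup>+V. ennreal (E j V) \<partial>\<gamma>) = (\<integral>\<^sup>+V. (\<Sum>x\<in>X j. \<Sum>y\<in>X j. ennreal (w j x * w j y) *
        ennreal (max (norm (orth_proj (V \<times> UNIV) (x - y))) ((1/2) ^ j) powr - s)) \<partial>\<gamma>)"
      unfolding E_def using w by (simp add: sum_ennreal [symmetric] ennreal_mult sum_nonneg)
    also have "\<dots> = (\<Sum>x\<in>X j. \<Sum>y\<in>X j. ennreal (w j x * w j y) *
        (\<integral>\<^sup>+V. ennreal (max (norm (orth_proj (V \<times> UNIV) (x - y))) ((1/2) ^ j) powr - s) \<partial>\<gamma>))"
      by (simp add: nn_integral_sum nn_integral_cmult)
    also have "\<dots> \<le> (\<Sum>x\<in>X j. \<Sum>y\<in>X j. ennreal (w j x * w j y) *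
        ennreal (C * max (norm (x - y)) ((1/2) ^ j) powr - s))"
      unfolding C_def using s
      by (intro sum_mono mult_left_mono nn_integral_orth_proj_Times_powr_le [OF \<gamma>]) auto
    also have "\<dots> = (\<Sum>x\<in>X j. \<Sum>y\<in>X j.
        ennreal (C * (w j x * w j y * max (norm (x - y)) ((1/2) ^ j) powr - s)))"
      by (intro sum.cong refl) (use w \<open>0 \<le> C\<close> in \<open>simp add: ennreal_mult [symmetric] mult.left_commute\<close>)
    also have "\<dots> = ennreal (\<Sum>x\<in>X j. \<Sum>y\<in>X j.
        C * (w j x * w j y * max (norm (x - y)) ((1/2) ^ j) powr - s))"
      using w \<open>0 \<le> C\<close> by (simp add: sum_ennreal sum_nonneg)
    also have "\<dots> = ennreal (C * (\<Sum>x\<in>X j. \<Sum>y\<in>X j. w j x * w j y * max (norm (x - y)) ((1/2) ^ j) powr - s))"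
      by (simp only: sum_distrib_left)
    also have "\<dots> \<le> ennreal (C * c)" using energy \<open>0 \<le> C\<close> by (intro ennreal_leI mult_left_mono)
    finally show ?thesis .
  qed
  have meas: "(\<lambda>V. ennreal (E j V)) \<in> borel_measurable \<gamma>" for j
    unfolding E_def by measurable
  have "(\<integral>\<^sup>+V. liminf (\<lambda>j. ennreal (E j V)) \<partial>\<gamma>) \<le> liminf (\<lambda>j. \<integral>\<^sup>+V. ennreal (E j V) \<partial>\<gamma>)"
    by (intro nn_integral_liminf meas)
  also have "\<dots> \<le> liminf (\<lambda>j. ennreal (C * c))"
    using E_le by (intro Liminf_mono) auto
  also have "\<dots> < \<infinity>" by (simp add: Liminf_const)
  finally have "AE V in \<gamma>. liminf (\<lambda>j. ennreal (E j V)) \<noteq> \<infinity>"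
    by (intro nn_integral_noteq_infinite borel_measurable_liminf meas) auto
  then show ?thesis
  proof (rule AE_mp, intro AE_I2 impI)
    fix V assume V: "V \<in> space \<gamma>" and fin: "liminf (\<lambda>j. ennreal (E j V)) \<noteq> \<infinity>"
    let ?P = "orth_proj (V \<times> (UNIV :: 'b set))"
    have subV: "subspace (V \<times> (UNIV :: 'b set))" using sub [OF V] by (intro subspace_Times) auto
    obtain L where L: "liminf (\<lambda>j. ennreal (E j V)) < ennreal L"
    proof -
      obtain n :: nat where "liminf (\<lambda>j. ennreal (E j V)) < of_nat n"
        using fin ennreal_Ex_less_of_nat [of "liminf (\<lambda>j. ennreal (E j V))"] by (auto simp: less_top)
      then show thesis using that [of "real n"] by (simp add: ennreal_of_nat_eq_real_of_nat)
    qed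
    have freq: "frequently (\<lambda>j. E j V \<le> L) sequentially"
    proof (rule ccontr)
      assume "\<not> frequently (\<lambda>j. E j V \<le> L) sequentially"
      then have "eventually (\<lambda>j. \<not> E j V \<le> L) sequentially" by (simp add: frequently_def)
      then have "eventually (\<lambda>j. ennreal L \<le> ennreal (E j V)) sequentially"
        by eventually_elim (auto intro: ennreal_leI)
      then have "ennreal L \<le> liminf (\<lambda>j. ennreal (E j V))" by (rule Liminf_bounded)
      with L show False by simp
    qed
    have nz: "hausdorff_measure s' (?P ` K) \<noteq> 0" if "0 \<le> s'" "s' \<le> s" for s'
    proof (rule hausdorff_measure_image_nonzero [OF _ K(1) s(1) that K(3) X w total ev])
      show "continuous_on UNIV ?P"
        by (rule linear_continuous_on [OF bounded_linear_orth_proj [OF subV]])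
      show "frequently (\<lambda>j. (\<Sum>x\<in>X j. \<Sum>y\<in>X j. w j x * w j y *
          max (dist (?P x) (?P y)) ((1/2) ^ j) powr - s) \<le> L) sequentially"
        using freq by (simp add: E_def dist_norm orth_proj_diff [OF subV])
    qed
    then have "hausdorff_measure s' (?P ` B) \<noteq> 0" if "0 \<le> s'" "s' \<le> s" for s'
      using nz [OF that]
        hausdorff_measure_mono [OF image_mono [OF K(2)], of s' ?P] by (metis le_zero_eq)
    then show "ennreal s \<le> hausdorff_dim (?P ` B)" by (rule le_hausdorff_dim)
  qed
qed

theorem proposition1p2:
  fixes l m n :: nat
    and B :: "((real ^ 'p) \<times> (real ^ 'q)) set"
    and \<gamma> :: "(real ^ 'p) set measure"
  assumes "0 < l" and "l < m" and "m < n"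
    and "CARD('p) = n - l" and "CARD('q) = l"
    and "analytic_set B"
    and "hausdorff_dim B \<le> of_nat (m - l)"
    and "invariant_grassmann_measure (m - l) \<gamma>"
  shows "AE V in \<gamma>. hausdorff_dim (orth_proj (V \<times> UNIV) ` B) = hausdorff_dim B"
proof -
  note \<gamma> = assms(8)
  have upper: "hausdorff_dim (orth_proj (V \<times> UNIV) ` B) \<le> hausdorff_dim B" if "V \<in> space \<gamma>" for V
  proof (rule hausdorff_dim_contraction_le)
    have sub: "subspace (V \<times> (UNIV :: (real ^ 'q) set))"
      using that by (intro subspace_Times) (auto simp: space_grassmann [OF \<gamma>] grassmannian_def)
    show "dist (orth_proj (V \<times> UNIV) x) (orth_proj (V \<times> UNIV) y) \<le> dist x y" for x y :: "(real ^ 'p) \<times> (real ^ 'q)"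
      using norm_orth_proj_le [OF sub, of "x - y"] by (simp add: dist_norm orth_proj_diff [OF sub])
  qed
  \<comment> \<open>This makes the dimension finite and puts every exponent below it under the
    threshold \<open>m - l\<close> of the average.\<close>
  have "hausdorff_dim B \<le> ennreal (real (m - l))"
    using assms(7) by (simp add: ennreal_of_nat_eq_real_of_nat)
  then obtain d where d: "hausdorff_dim B = ennreal d" "0 \<le> d" "d \<le> real (m - l)"
    by (cases "hausdorff_dim B") (auto simp: top_unique)
  \<comment> \<open>Countably many exponents increasing to \<open>d\<close> leave a null set of
    exceptional subspaces. The double \<open>Suc\<close> makes \<open>s 0 = d / 2\<close>, which is
    positive when \<open>d\<close> is.\<close>
  define s where "s i = d * (1 - 1 / real (Suc (Suc i)))" for i
  have "AE V in \<gamma>. ennreal (s i) \<le> hausdorff_dim (orth_proj (V \<times> UNIV) ` B)" for i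
  proof (cases "d = 0")
    case False
    then have "0 < s i" "s i < d" using d(2) by (auto simp: s_def field_simps add_pos_nonneg)
    then obtain t where t: "s i < t" "t < d" using dense by blast
    have "hausdorff_measure t B \<noteq> 0"
      using t \<open>0 < s i\<close> d by (intro hausdorff_measure_nonzero_of_less_dim) (auto simp: ennreal_less_iff)
    then show ?thesis
      using \<open>0 < s i\<close> t d by (intro AE_le_hausdorff_dim_projection [OF \<gamma> assms(6)]) auto
  qed (simp add: s_def)
  then have "AE V in \<gamma>. \<forall>i. ennreal (s i) \<le> hausdorff_dim (orth_proj (V \<times> UNIV) ` B)"
    by (simp add: AE_all_countable)
  then show ?thesis
  proof (rule AE_mp, intro AE_I2 impI)
    fix V assume V: "V \<in> space \<gamma>" and le: "\<forall>i. ennreal (s i) \<le> hausdorff_dim (orth_proj (V \<times> UNIV) ` B)"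
    have "(\<lambda>i. d * (1 - 1 / real (Suc (Suc i)))) \<longlonglongrightarrow> d * (1 - 0)"
      by (intro tendsto_intros filterlim_compose [OF LIMSEQ_inverse_real_of_nat [unfolded inverse_eq_divide] filterlim_Suc])
    then have "s \<longlonglongrightarrow> d" unfolding s_def by simp
    then have "(\<lambda>i. ennreal (s i)) \<longlonglongrightarrow> ennreal d" by (rule tendsto_ennrealI)
    then have "ennreal d \<le> hausdorff_dim (orth_proj (V \<times> UNIV) ` B)"
      by (rule LIMSEQ_le_const2) (use le in blast)
    with upper [OF V] d show "hausdorff_dim (orth_proj (V \<times> UNIV) ` B) = hausdorff_dim B" by simp
  qed
qed

end
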